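(* Let $G:\mathbf V\to\mathbb R$ be convex and $\beta$-smooth, $H:\mathbf V\to\mathbb R$ be $\mu$-strongly convex and $w:\mathbf V\to\mathbb R$ be $\nu$-strongly convex, all with respect to the same norm $\|\cdot\|$, with $\beta,\mu,\nu>0$. Let $F=G+H$. Let $(y_k),(z_k),(v_k),(d_k),(A_k),(g_k)$ be generated by the stochastic composite minimization algorithm described in the context, and suppose that for every $k\in\mathbb N$ the stochastic gradients satisfy $\mathbb E_k[g_k]=\nabla G(v_k)$ and $\mathbb E_k\|g_k-\nabla G(v_k)\|_*^2\le\sigma^2$. Let $y_\star\in\arg\min F$ and define $D_w(y_\star,y_0)=w(y_\star)-w(y_0)\ge 0$. Then after $k\ge 1$ iterations, $$\mathbb E[F(y_k)-F(y_\star)]\le \frac{\sqrt\beta+\sqrt\mu}{\nu\sqrt\beta}\exp\left(-\frac{(k-1)\sqrt\mu}{4(\sqrt\beta+\sqrt\mu)}\right)\beta\, D_w(y_\star,y_0)+\frac{\sigma^2}{2\sqrt{\mu\beta}}.$$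
   Context: $\mathbf V$ is a real finite-dimensional vector space with norm $\|\cdot\|$, $\mathbf V^*$ its dual space, $\langle\cdot,\cdot\rangle:\mathbf V^*\times\mathbf V\to\mathbb R$ the dual pairing, and $\|z\|_*=\sup_{\|x\|\le1}\langle z,x\rangle$ the dual norm. $\partial\Psi(x)$ is the set of subgradients of a convex function $\Psi$ at $x$. A differentiable function $\Psi:\mathbf V\to\mathbb R$ is $L$-smooth w.r.t. $\|\cdot\|$ if $\|\nabla\Psi(x)-\nabla\Psi(y)\|_*\le L\|x-y\|$ for all $x,y$. A (closed, proper) convex function $\Psi:\mathbf V\to\mathbb R$ is $\mu$-strongly convex w.r.t. $\|\cdot\|$ if $\Psi(x)\ge\Psi(y)+\langle g,x-y\rangle+\frac\mu2\|x-y\|^2$ for all $x,y\in\mathbf V$ and all $g\in\partial\Psi(y)$. Algorithm (stochastic composite minimization). Pick $z_0\in\arg\min_y w(y)$, set $y_0=z_0$, $A_0=0\in\mathbb R$, $d_0=0\in\mathbf V^*$. For $k=0,1,2,\dots$: $$A_{k+1}=\frac{A_k(\mu+2\beta+\sqrt{\mu\beta})+\beta\nu+\sqrt{(\beta\nu+\mu A_k)^2+4A_k\beta^2\nu+5A_k^2\mu\beta+2A_k\sqrt{\mu\beta}\,(\beta\nu+A_k\mu)}}{2(\beta+\sqrt{\mu\beta})},$$ $\tau_k=1-\frac{A_k}{A_{k+1}}$; $v_k=(1-\tau_k)y_k+\tau_k z_k$; obtain a random stochastic gradient $g_k\in\mathbf V^*$ of $G$ at $v_k$; $d_{k+1}=d_k+(A_{k+1}-A_k)g_k$;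 $z_{k+1}\in\arg\min_{y\in\mathbf V}\{\langle d_{k+1},y\rangle+A_{k+1}H(y)+\beta w(y)\}$; $y_{k+1}=(1-\tau_k)y_k+\tau_k z_{k+1}$. $\mathbb E_k$ denotes expectation at iteration $k$ conditioned on the previous iterations (i.e. conditioned on $y_k,z_k,d_k$ and $c_k=\sum_{i=0}^{k-1}(A_{i+1}-A_i)(G(v_i)-\langle\nabla G(v_i),v_i\rangle)$), and $\mathbb E$ denotes total expectation. *)

theory Defs
  imports "HOL-Probability.Probability"
begin

text \<open>The dual space of \<open>'a\<close> is the type \<open>'a \<Rightarrow>\<^sub>L real\<close>, whose application is the dual pairing.
  Its operator norm is the dual norm:\<close>

lemma dual_norm_eq_SUP:
  fixes z :: "'a::real_normed_vector \<Rightarrow>\<^sub>L real"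
  shows "norm z = (SUP x\<in>{x. norm x \<le> 1}. blinfun_apply z x)"
proof (rule antisym)
  let ?B = "{x::'a. norm x \<le> 1}"
  have le: "blinfun_apply z x \<le> norm z" if "x \<in> ?B" for x
  proof -
    have "blinfun_apply z x \<le> norm (blinfun_apply z x)" by simp
    also have "\<dots> \<le> norm z * norm x" by (rule norm_blinfun)
    also have "\<dots> \<le> norm z * 1" using that by (intro mult_left_mono) auto
    finally show ?thesis by simp
  qed
  have bdd: "bdd_above (blinfun_apply z ` ?B)" using le by (auto intro!: bdd_aboveI)
  show "(SUP x\<in>?B. blinfun_apply z x) \<le> norm z"
    by (rule cSUP_least) (use le in \<open>auto intro: exI[of _ 0]\<close>)
  let ?S = "SUP x\<in>?B. blinfun_apply z x"
  have up: "blinfun_apply z x \<le> ?S" if "norm x \<le> 1" for x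
    using that bdd by (intro cSUP_upper) auto
  have S0: "0 \<le> ?S" using up[of 0] by (simp add: blinfun.zero_right)
  have *: "blinfun_apply z x \<le> ?S * norm x" for x
  proof (cases "x = 0")
    case False
    then have "blinfun_apply z (x /\<^sub>R norm x) \<le> ?S" by (intro up) simp
    then show ?thesis using False by (simp add: blinfun.scaleR_right field_simps)
  qed (simp add: blinfun.zero_right)
  show "norm z \<le> ?S"
  proof (rule norm_blinfun_bound[OF S0])
    fix x show "norm (blinfun_apply z x) \<le> ?S * norm x"
      using *[of x] *[of "- x"] by (simp add: blinfun.minus_right)
  qed
qed

definition subdifferential :: "('a::real_normed_vector \<Rightarrow> real) \<Rightarrow> 'a \<Rightarrow> ('a \<Rightarrow>\<^sub>L real) set"
  where "subdifferential \<Psi> x = {g. \<forall>y. \<Psi> y \<ge> \<Psi> x + blinfun_apply g (y - x)}"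

text \<open>Only meaningful where \<open>\<Psi>\<close> is differentiable.\<close>

definition grad :: "('a::real_normed_vector \<Rightarrow> real) \<Rightarrow> 'a \<Rightarrow> 'a \<Rightarrow>\<^sub>L real"
  where "grad \<Psi> x = Blinfun (frechet_derivative \<Psi> (at x))"

definition smooth_wrt_norm :: "real \<Rightarrow> ('a::real_normed_vector \<Rightarrow> real) \<Rightarrow> bool"
  where "smooth_wrt_norm L \<Psi> \<longleftrightarrow>
    (\<forall>x. \<Psi> differentiable at x) \<and> (\<forall>x y. norm (grad \<Psi> x - grad \<Psi> y) \<le> L * norm (x - y))"

text \<open>Closedness and properness are automatic here: the functions are finite everywhere, and on a
  finite-dimensional space such convex functions are continuous.\<close>

definition strongly_convex :: "real \<Rightarrow> ('a::real_normed_vector \<Rightarrow> real) \<Rightarrow> bool"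
  where "strongly_convex m \<Psi> \<longleftrightarrow> convex_on UNIV \<Psi> \<and>
    (\<forall>x y. \<forall>g\<in>subdifferential \<Psi> y.
       \<Psi> x \<ge> \<Psi> y + blinfun_apply g (x - y) + m / 2 * (norm (x - y))\<^sup>2)"

primrec scm_A :: "real \<Rightarrow> real \<Rightarrow> real \<Rightarrow> nat \<Rightarrow> real" where
  "scm_A \<beta> \<mu> \<nu> 0 = 0"
| "scm_A \<beta> \<mu> \<nu> (Suc k) = (let A = scm_A \<beta> \<mu> \<nu> k in
     (A * (\<mu> + 2 * \<beta> + sqrt (\<mu> * \<beta>)) + \<beta> * \<nu>
        + sqrt ((\<beta> * \<nu> + \<mu> * A)\<^sup>2 + 4 * A * \<beta>\<^sup>2 * \<nu> + 5 * A\<^sup>2 * \<mu> * \<beta>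
                  + 2 * A * sqrt (\<mu> * \<beta>) * (\<beta> * \<nu> + A * \<mu>)))
     / (2 * (\<beta> + sqrt (\<mu> * \<beta>))))"

definition scm_tau :: "real \<Rightarrow> real \<Rightarrow> real \<Rightarrow> nat \<Rightarrow> real"
  where "scm_tau \<beta> \<mu> \<nu> k = 1 - scm_A \<beta> \<mu> \<nu> k / scm_A \<beta> \<mu> \<nu> (Suc k)"

text \<open>The sequences produced by a single run that starts at \<open>y0\<close> and receives the stochastic
  gradients \<open>g\<close>.\<close>

definition scm_run :: "real \<Rightarrow> real \<Rightarrow> real \<Rightarrow> ('a::real_normed_vector \<Rightarrow> real) \<Rightarrow> ('a \<Rightarrow> real) \<Rightarrow> 'a \<Rightarrow>
    (nat \<Rightarrow> 'a \<Rightarrow>\<^sub>L real) \<Rightarrow> (nat \<Rightarrow> 'a) \<Rightarrow> (nat \<Rightarrow> 'a) \<Rightarrow> (nat \<Rightarrow> 'a) \<Rightarrow> (nat \<Rightarrow> 'a \<Rightarrow>\<^sub>L real) \<Rightarrow> bool"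
  where "scm_run \<beta> \<mu> \<nu> H w y0 g y z v d \<longleftrightarrow>
    (let A = scm_A \<beta> \<mu> \<nu>; \<tau> = scm_tau \<beta> \<mu> \<nu> in
      is_arg_min w (\<lambda>_. True) y0 \<and> z 0 = y0 \<and> y 0 = y0 \<and> d 0 = 0 \<and>
      (\<forall>k. v k = (1 - \<tau> k) *\<^sub>R y k + \<tau> k *\<^sub>R z k \<and>
           d (Suc k) = d k + (A (Suc k) - A k) *\<^sub>R g k \<and>
           is_arg_min (\<lambda>x. blinfun_apply (d (Suc k)) x + A (Suc k) * H x + \<beta> * w x)
             (\<lambda>_. True) (z (Suc k)) \<and>
           y (Suc k) = (1 - \<tau> k) *\<^sub>R y k + \<tau> k *\<^sub>R z (Suc k)))"

definition scm_c :: "real \<Rightarrow> real \<Rightarrow> real \<Rightarrow> ('a::real_normed_vector \<Rightarrow> real) \<Rightarrow> (nat \<Rightarrow> 'a) \<Rightarrow> nat \<Rightarrow> real"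
  where "scm_c \<beta> \<mu> \<nu> G v k =
    (\<Sum>i<k. (scm_A \<beta> \<mu> \<nu> (Suc i) - scm_A \<beta> \<mu> \<nu> i) * (G (v i) - blinfun_apply (grad G (v i)) (v i)))"

text \<open>The sigma-algebra generated by \<open>y k\<close>, \<open>z k\<close>, \<open>d k\<close> and \<open>c k\<close>.\<close>

definition scm_history :: "real \<Rightarrow> real \<Rightarrow> real \<Rightarrow> ('a::real_normed_vector \<Rightarrow> real) \<Rightarrow> 'w measure \<Rightarrow>
    (nat \<Rightarrow> 'w \<Rightarrow> 'a) \<Rightarrow> (nat \<Rightarrow> 'w \<Rightarrow> 'a) \<Rightarrow> (nat \<Rightarrow> 'w \<Rightarrow> 'a) \<Rightarrow> (nat \<Rightarrow> 'w \<Rightarrow> 'a \<Rightarrow>\<^sub>L real) \<Rightarrow>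
    nat \<Rightarrow> 'w measure"
  where "scm_history \<beta> \<mu> \<nu> G M y z v d k =
    vimage_algebra (space M)
      (\<lambda>\<omega>. (y k \<omega>, z k \<omega>, d k \<omega>, scm_c \<beta> \<mu> \<nu> G (\<lambda>i. v i \<omega>) k))
      (borel \<Otimes>\<^sub>M borel \<Otimes>\<^sub>M borel \<Otimes>\<^sub>M borel)"

text \<open>\<open>X\<close> is integrable with conditional expectation \<open>Y\<close> given \<open>F\<close>, for dual vectors \<open>X\<close> and \<open>Y\<close>.
  On a finite-dimensional space the pairings with vectors amount to coordinates.\<close>

definition has_dual_cond_exp :: "'w measure \<Rightarrow> 'w measure \<Rightarrow>
    ('w \<Rightarrow> 'a::real_normed_vector \<Rightarrow>\<^sub>L real) \<Rightarrow> ('w \<Rightarrow> 'a \<Rightarrow>\<^sub>L real) \<Rightarrow> bool"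
  where "has_dual_cond_exp M F X Y \<longleftrightarrow>
    (\<forall>x. integrable M (\<lambda>\<omega>. blinfun_apply (X \<omega>) x) \<and>
         (AE \<omega> in M. real_cond_exp M F (\<lambda>\<omega>. blinfun_apply (X \<omega>) x) \<omega> = blinfun_apply (Y \<omega>) x))"

definition D_gap :: "('a \<Rightarrow> real) \<Rightarrow> 'a \<Rightarrow> 'a \<Rightarrow> real"
  where "D_gap w x y = w x - w y"

end

theory Submission
  imports Defs
begin

text \<open>
  The algorithm is dual averaging with an estimate sequence. The model
  \<open>\<psi>\<^sub>k(x) = \<Sum>i<k. (A (Suc i) - A i) * (G (v i) - \<langle>\<nabla>G (v i), v i\<rangle> + \<langle>g i, x\<rangle>) + A k * H x + \<beta> * w x\<close>
  is minimized by \<open>z k\<close> and is strongly convex with modulus \<open>\<beta> * \<nu> + \<mu> * A k\<close>. Write \<open>\<delta> i = g i - \<nabla>G (v i)\<close>.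
  Passing from \<open>k\<close> to \<open>Suc k\<close> with \<open>a = A (Suc k) - A k\<close>, strong convexity gains half the modulus times
  \<open>r\<^sup>2\<close>, where \<open>r\<close> is the distance from \<open>z k\<close> to \<open>z (Suc k)\<close>, and smoothness of \<open>G\<close> costs
  \<open>\<beta> * a\<^sup>2 / (2 * A (Suc k)) * r\<^sup>2\<close>. The recursion for \<open>A\<close> is designed so that the difference is exactly
  \<open>sqrt (\<mu> * \<beta>) * a / 2 * r\<^sup>2\<close> (\<open>scm_A_increment_equation\<close>). By Young's inequality this absorbs the pairing of
  \<open>\<delta> k\<close> with \<open>z k - z (Suc k)\<close> at the price \<open>a * (norm (\<delta> k))\<^sup>2 / (2 * sqrt (\<mu> * \<beta>))\<close>
  (\<open>composite_dual_averaging_step\<close>). Telescoping and comparing the model with its value at \<open>ystar\<close> gives, along every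
  run, the bound of \<open>scm_pathwise_bound\<close>:
  \<open>A k * (F (y k) - F ystar)\<close> is at most \<open>\<beta> * (w ystar - w y0)\<close> plus the weighted sum of
  \<open>\<langle>\<delta> i, ystar - z i\<rangle> + (norm (\<delta> i))\<^sup>2 / (2 * sqrt (\<mu> * \<beta>))\<close>.

  In expectation the pairings vanish, because \<open>z i\<close> is known before \<open>g i\<close> is drawn (\<open>\<delta>_mean_zero\<close>), and the
  squares are at most \<open>\<sigma>\<^sup>2\<close>. Division by \<open>A k\<close>, which grows geometrically (\<open>scm_A_lower_bound\<close>), gives
  the rate; the noise does not accumulate because its weights add up to \<open>A k\<close>.

  Two facts of finite-dimensional analysis support this. The subgradient form of strong convexity is informative only
  because subgradients exist (\<open>subdifferential_nonempty\<close>). The minimizers \<open>z k\<close> are Lipschitz functions of \<open>d k\<close>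
  (\<open>arg_min_lipschitz\<close>); hence the iterates are random variables and inherit square integrability from the
  noise, as the mean-zero argument requires.
\<close>

section \<open>Coordinates in a finite-dimensional normed space\<close>

text \<open>Vectors \<open>b i\<close> with continuous functionals \<open>\<phi> i\<close> that recover every vector from finitely many
  scalars. A space with a finite spanning set has such a system and its dual space inherits one, so that the
  same lemma serves measurability in both. The index type \<open>nat\<close> is countable, which makes coordinatewise
  measurability sufficient.\<close>

definition coordinate_system ::
    "nat \<Rightarrow> (nat \<Rightarrow> 'a::real_normed_vector) \<Rightarrow> (nat \<Rightarrow> 'a \<Rightarrow>\<^sub>L real) \<Rightarrow> bool"
  where "coordinate_system n b \<phi> \<longleftrightarrow> (\<forall>x. (\<Sum>i<n. \<phi> i x *\<^sub>R b i) = x)"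

lemma coordinate_system_expand:
  assumes "coordinate_system n b \<phi>"
  shows "(\<Sum>i<n. \<phi> i x *\<^sub>R b i) = x"
  using assms unfolding coordinate_system_def by blast

lemma compact_coefficient_sphere:
  "compact {c::nat \<Rightarrow> real. (\<forall>i\<ge>n. c i = 0) \<and> (\<Sum>i<n. \<bar>c i\<bar>) = 1}"
proof -
  let ?K = "PiE UNIV (\<lambda>i::nat. if i < n then {-1..1} else {0::real})"
  let ?S = "{c::nat \<Rightarrow> real. (\<Sum>i<n. \<bar>c i\<bar>) = 1}"
  have "compactin (product_topology (\<lambda>_. euclidean) UNIV) ?K"
    by (subst compactin_PiE) auto
  then have K: "compact ?K"
    by (simp add: euclidean_product_topology)
  have "closed ((\<lambda>c::nat \<Rightarrow> real. \<Sum>i<n. \<bar>c i\<bar>) -` {1})"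
    by (intro continuous_closed_vimage continuous_intros)
       (simp add: continuous_on_eq_continuous_at[symmetric])
  then have "closed ?S" by (simp add: vimage_def)
  with K have "compact (?K \<inter> ?S)" by (rule compact_Int_closed)
  moreover have "?K \<inter> ?S = {c. (\<forall>i\<ge>n. c i = 0) \<and> (\<Sum>i<n. \<bar>c i\<bar>) = 1}"
  proof (intro set_eqI iffI)
    fix c :: "nat \<Rightarrow> real" assume c: "c \<in> {c. (\<forall>i\<ge>n. c i = 0) \<and> (\<Sum>i<n. \<bar>c i\<bar>) = 1}"
    then have "\<bar>c i\<bar> \<le> 1" if "i < n" for i
      using member_le_sum[of i "{..<n}" "\<lambda>i. \<bar>c i\<bar>"] that by auto
    then show "c \<in> ?K \<inter> ?S" using c by (auto simp: abs_le_iff)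
  qed (auto simp: PiE_iff not_less split: if_splits)
  ultimately show ?thesis by simp
qed

text \<open>All norms on a finite-dimensional space are equivalent: on the compact \<open>\<ell>\<^sub>1\<close>-sphere of
  coefficients the norm of the combination attains a minimum, which independence makes positive;
  homogeneity does the rest. This is what makes coordinate functionals continuous.\<close>

lemma independent_coefficients_bounded:
  fixes b :: "nat \<Rightarrow> 'a::real_normed_vector"
  assumes indep: "\<And>c. (\<Sum>i<n. c i *\<^sub>R b i) = 0 \<Longrightarrow> \<forall>i<n. c i = (0::real)"
  shows "\<exists>K. \<forall>c. (\<Sum>i<n. \<bar>c i\<bar>) \<le> K * norm (\<Sum>i<n. c i *\<^sub>R b i)"
proof (cases "n = 0")
  case False
  define S where "S = {c::nat \<Rightarrow> real. (\<forall>i\<ge>n. c i = 0) \<and> (\<Sum>i<n. \<bar>c i\<bar>) = 1}"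
  have "(\<Sum>i<n. \<bar>if i = 0 then 1 else 0::real\<bar>) = 1"
    using False by (simp add: if_distrib[of abs] sum.delta cong: if_cong)
  with False have "(\<lambda>i. if i = 0 then 1 else 0) \<in> S" by (auto simp: S_def)
  then have "S \<noteq> {}" by auto
  moreover have "compact S" unfolding S_def by (rule compact_coefficient_sphere)
  moreover have "continuous_on S (\<lambda>c. norm (\<Sum>i<n. c i *\<^sub>R b i))"
    by (intro continuous_intros continuous_on_subset[OF continuous_on_product_coordinates]) auto
  ultimately obtain m where m: "m \<in> S"
    and least: "\<And>c. c \<in> S \<Longrightarrow> norm (\<Sum>i<n. m i *\<^sub>R b i) \<le> norm (\<Sum>i<n. c i *\<^sub>R b i)"
    using continuous_attains_inf[of S "\<lambda>c. norm (\<Sum>i<n. c i *\<^sub>R b i)"] by metis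
  define e where "e = norm (\<Sum>i<n. m i *\<^sub>R b i)"
  have "e \<noteq> 0"
  proof
    assume "e = 0"
    then have "\<forall>i<n. m i = 0" unfolding e_def by (intro indep) simp
    then show False using m by (simp add: S_def)
  qed
  then have e: "e > 0" by (simp add: e_def)
  have "(\<Sum>i<n. \<bar>c i\<bar>) \<le> (1 / e) * norm (\<Sum>i<n. c i *\<^sub>R b i)" for c
  proof (cases "(\<Sum>i<n. \<bar>c i\<bar>) = 0")
    case True then show ?thesis using e by simp
  next
    case False
    define s where "s = (\<Sum>i<n. \<bar>c i\<bar>)"
    have s: "s > 0" using False unfolding s_def by (simp add: less_le sum_nonneg)
    define c' where "c' i = (if i < n then c i / s else 0)" for i
    have "(\<Sum>i<n. \<bar>c' i\<bar>) = (\<Sum>i<n. \<bar>c i\<bar> / s)" using s by (intro sum.cong) (auto simp: c'_def)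
    also have "\<dots> = 1" using s by (simp add: sum_divide_distrib[symmetric] s_def[symmetric])
    finally have "c' \<in> S" by (auto simp: S_def c'_def)
    then have "e \<le> norm (\<Sum>i<n. c' i *\<^sub>R b i)" unfolding e_def by (rule least)
    also have "(\<Sum>i<n. c' i *\<^sub>R b i) = (\<Sum>i<n. c i *\<^sub>R b i) /\<^sub>R s"
      by (simp add: scaleR_sum_right c'_def divide_inverse mult.commute)
    finally show ?thesis using s e by (simp add: s_def[symmetric] field_simps)
  qed
  then show ?thesis by blast
qed auto

lemma coordinate_system_exists:
  assumes "\<exists>B::'a::real_normed_vector set. finite B \<and> span B = UNIV"
  shows "\<exists>n b (\<phi>::nat \<Rightarrow> 'a \<Rightarrow>\<^sub>L real). coordinate_system n b \<phi>"
proof -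
  obtain B0 :: "'a set" where B0: "finite B0" "span B0 = UNIV" using assms by auto
  obtain B where B: "B \<subseteq> B0" "independent B" "span B0 \<subseteq> span B"
    using maximal_independent_subset[of B0] by (metis span_mono span_span)
  have fin: "finite B" using B B0 finite_subset by blast
  have spn: "span B = UNIV" using B B0 by auto
  define n where "n = card B"
  obtain b where b: "bij_betw b {..<n} B"
    using ex_bij_betw_nat_finite[OF fin] unfolding n_def atLeast0LessThan by blast
  define r where "r i x = representation B x (b i)" for i x
  have expand: "(\<Sum>i<n. r i x *\<^sub>R b i) = x" for x
    unfolding r_def sum.reindex_bij_betw[OF b, of "\<lambda>v. representation B x v *\<^sub>R v"]
    using sum_representation_eq[of B x B] B fin spn by auto
  have indep: "\<forall>i<n. c i = 0" if "(\<Sum>i<n. c i *\<^sub>R b i) = 0" for c :: "nat \<Rightarrow> real"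
  proof -
    define h where "h = inv_into {..<n} b"
    have hb: "h (b i) = i" if "i < n" for i
      unfolding h_def using b that by (intro inv_into_f_f) (auto simp: bij_betw_def)
    have "(\<Sum>v\<in>B. c (h v) *\<^sub>R v) = (\<Sum>i<n. c (h (b i)) *\<^sub>R b i)"
      using sum.reindex_bij_betw[OF b, of "\<lambda>v. c (h v) *\<^sub>R v"] by simp
    also have "\<dots> = (\<Sum>i<n. c i *\<^sub>R b i)" by (intro sum.cong) (auto simp: hb)
    finally have "(\<Sum>v\<in>B. c (h v) *\<^sub>R v) = 0" using that by simp
    then have z: "\<forall>v\<in>B. c (h v) = 0" using independentD[OF B(2) fin subset_refl, of "\<lambda>v. c (h v)"] by simp
    show ?thesis
    proof (intro allI impI)
      fix i assume i: "i < n"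
      then have "b i \<in> B" using b by (auto simp: bij_betw_def)
      then show "c i = 0" using z hb[OF i] by metis
    qed
  qed
  obtain K where K: "\<And>c. (\<Sum>i<n. \<bar>c i\<bar>) \<le> K * norm (\<Sum>i<n. c i *\<^sub>R b i)"
    using independent_coefficients_bounded[OF indep] by blast
  have "bounded_linear (r i)" if i: "i < n" for i
  proof (rule bounded_linear_intro)
    show "r i (x + y) = r i x + r i y" for x y
      unfolding r_def using representation_add[OF B(2)] spn by auto
    show "r i (c *\<^sub>R x) = c *\<^sub>R r i x" for c x
      unfolding r_def using representation_scale[OF B(2)] spn by auto
    show "norm (r i x) \<le> norm x * K" for x
      using order_trans[OF member_le_sum[of i "{..<n}" "\<lambda>i. \<bar>r i x\<bar>"] K[of "\<lambda>i. r i x"]] i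
      by (simp add: expand mult.commute)
  qed
  then have "coordinate_system n b (\<lambda>i. Blinfun (r i))"
    unfolding coordinate_system_def
    by (simp add: expand bounded_linear_Blinfun_apply)
  then show ?thesis by blast
qed

lemma coordinate_system_dual:
  assumes "coordinate_system n b \<phi>"
  shows "coordinate_system n \<phi> (\<lambda>i. Blinfun (\<lambda>f. blinfun_apply f (b i)))"
  unfolding coordinate_system_def
proof (intro allI blinfun_eqI)
  fix f :: "'a \<Rightarrow>\<^sub>L real" and x
  have bl: "bounded_linear (\<lambda>f. blinfun_apply f (b i))" for i
    by (rule blinfun.bounded_linear_left)
  have "f x = f (\<Sum>i<n. \<phi> i x *\<^sub>R b i)"
    using coordinate_system_expand[OF assms, of x] by simp
  also have "\<dots> = (\<Sum>i<n. f (b i) * \<phi> i x)"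
    by (simp add: blinfun.sum_right blinfun.scaleR_right mult.commute)
  finally show "blinfun_apply (\<Sum>i<n. blinfun_apply (Blinfun (\<lambda>f. blinfun_apply f (b i))) f *\<^sub>R \<phi> i) x =
      blinfun_apply f x"
    by (simp add: bounded_linear_Blinfun_apply[OF bl] blinfun.sum_left blinfun.scaleR_left)
qed

lemma borel_measurable_if_coordinates:
  fixes f :: "'w \<Rightarrow> 'a::real_normed_vector"
  assumes "coordinate_system n b \<phi>"
    and [measurable]: "\<And>i. (\<lambda>\<omega>. \<phi> i (f \<omega>)) \<in> borel_measurable M"
  shows "f \<in> borel_measurable M"
proof -
  have "continuous_on UNIV (\<lambda>c::nat \<Rightarrow> real. \<Sum>i<n. c i *\<^sub>R b i)"
    by (intro continuous_intros) simp
  then have [measurable]: "(\<lambda>c::nat \<Rightarrow> real. \<Sum>i<n. c i *\<^sub>R b i) \<in> borel_measurable borel"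
    by (rule borel_measurable_continuous_onI)
  have [measurable]: "(\<lambda>\<omega> i. blinfun_apply (\<phi> i) (f \<omega>)) \<in> borel_measurable M"
    by (rule measurable_coordinatewise_then_product) measurable
  have "(\<lambda>\<omega>. (\<lambda>c. \<Sum>i<n. c i *\<^sub>R b i) (\<lambda>i. \<phi> i (f \<omega>))) \<in> borel_measurable M"
    by measurable
  then show ?thesis using coordinate_system_expand[OF assms(1)] by simp
qed

lemma borel_measurable_blinfun_apply:
  fixes f :: "'w \<Rightarrow> 'a::real_normed_vector"
  assumes "f \<in> borel_measurable M"
  shows "(\<lambda>\<omega>. blinfun_apply \<phi> (f \<omega>)) \<in> borel_measurable M"
  by (rule borel_measurable_continuous_on[OF _ assms]) (intro continuous_intros)

lemma borel_measurable_blinfun_eval: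
  fixes f :: "'w \<Rightarrow> 'a::real_normed_vector \<Rightarrow>\<^sub>L real"
  assumes "f \<in> borel_measurable M"
  shows "(\<lambda>\<omega>. f \<omega> x) \<in> borel_measurable M"
  by (rule borel_measurable_continuous_on[OF _ assms]) (intro continuous_intros)

text \<open>Without a countable base as a type class constraint, sums of Borel functions need not be Borel.
  In coordinates the question reduces to real-valued functions.\<close>

lemma borel_measurable_lincomb:
  fixes f g :: "'w \<Rightarrow> 'a::real_normed_vector"
  assumes cs: "coordinate_system n b (\<phi>::nat \<Rightarrow> 'a \<Rightarrow>\<^sub>L real)"
    and f: "f \<in> borel_measurable M" and g: "g \<in> borel_measurable M"
  shows "(\<lambda>\<omega>. r *\<^sub>R f \<omega> + s *\<^sub>R g \<omega>) \<in> borel_measurable M"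
proof (rule borel_measurable_if_coordinates[OF cs])
  note [measurable] = borel_measurable_blinfun_apply[OF f] borel_measurable_blinfun_apply[OF g]
  show "(\<lambda>\<omega>. \<phi> i (r *\<^sub>R f \<omega> + s *\<^sub>R g \<omega>)) \<in> borel_measurable M" for i
    by (simp add: blinfun.add_right blinfun.scaleR_right)
qed

lemma borel_measurable_pairing:
  fixes f :: "'w \<Rightarrow> 'a::real_normed_vector \<Rightarrow>\<^sub>L real"
  assumes cs: "coordinate_system n b (\<phi>::nat \<Rightarrow> 'a \<Rightarrow>\<^sub>L real)"
    and f: "f \<in> borel_measurable M" and x: "x \<in> borel_measurable M"
  shows "(\<lambda>\<omega>. f \<omega> (x \<omega>)) \<in> borel_measurable M"
proof -
  note [measurable] = borel_measurable_blinfun_eval[OF f] borel_measurable_blinfun_apply[OF x]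
  have "f \<omega> (x \<omega>) = (\<Sum>i<n. \<phi> i (x \<omega>) * f \<omega> (b i))" for \<omega>
    by (subst coordinate_system_expand[OF cs, of "x \<omega>", symmetric])
       (simp add: blinfun.sum_right blinfun.scaleR_right)
  then show ?thesis by simp
qed

text \<open>Minimizers depend on the accumulated gradient in a Lipschitz way wherever they exist, so they are
  Borel functions of the outcome although no minimizer map is defined on the whole dual space: the
  preimage of an open set under \<open>h\<close> is the preimage under \<open>f\<close> of a union of balls.\<close>

lemma borel_measurable_lipschitz_factor:
  fixes f :: "'w \<Rightarrow> 'b::metric_space" and h :: "'w \<Rightarrow> 'c::metric_space"
  assumes f: "f \<in> borel_measurable M" and L: "L > 0"
    and lip: "\<And>\<omega> \<omega>'. \<omega> \<in> space M \<Longrightarrow> \<omega>' \<in> space M \<Longrightarrow> dist (h \<omega>) (h \<omega>') \<le> L * dist (f \<omega>) (f \<omega>')"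
  shows "h \<in> borel_measurable M"
proof (rule borel_measurableI)
  fix U :: "'c set" assume U: "open U"
  define V where "V = \<Union>{ball (f \<omega>) (e / L) |\<omega> e. \<omega> \<in> space M \<and> e > 0 \<and> ball (h \<omega>) e \<subseteq> U}"
  have "h -` U \<inter> space M = f -` V \<inter> space M"
  proof (intro set_eqI iffI)
    fix \<omega> assume w: "\<omega> \<in> h -` U \<inter> space M"
    then obtain e where e: "e > 0" "ball (h \<omega>) e \<subseteq> U"
      using U open_contains_ball[of U] by auto
    then have "f \<omega> \<in> ball (f \<omega>) (e / L)" using L by simp
    then show "\<omega> \<in> f -` V \<inter> space M" unfolding V_def using w e by blast
  next
    fix \<omega> assume w: "\<omega> \<in> f -` V \<inter> space M"
    then obtain \<omega>' e where *: "\<omega>' \<in> space M" "f \<omega> \<in> ball (f \<omega>') (e / L)" "ball (h \<omega>') e \<subseteq> U"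
      unfolding V_def by auto
    have "dist (h \<omega>') (h \<omega>) \<le> L * dist (f \<omega>') (f \<omega>)" using lip * w by auto
    also have "\<dots> < e" using * L by (simp add: field_simps)
    finally show "\<omega> \<in> h -` U \<inter> space M" using * w by auto
  qed
  moreover have "open V" unfolding V_def by (intro open_Union) auto
  ultimately show "h -` U \<inter> space M \<in> sets M" using f by (simp add: measurable_sets)
qed

section \<open>Subgradients and strong convexity\<close>

lemma convex_on_UNIV_comb:
  assumes "convex_on UNIV (f :: 'a::real_vector \<Rightarrow> real)" "0 \<le> t" "t \<le> 1"
  shows "f ((1 - t) *\<^sub>R x + t *\<^sub>R y) \<le> (1 - t) * f x + t * f y"
  using convex_onD[OF assms(1), of t x y] assms by simp

lemma convex_on_line:
  assumes "convex_on UNIV (f :: 'a::real_vector \<Rightarrow> real)"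
  shows "convex_on UNIV (\<lambda>t::real. f (x + t *\<^sub>R u))"
proof (rule convex_onI)
  fix t s r :: real assume t: "0 < t" "t < 1"
  have "x + ((1 - t) *\<^sub>R s + t *\<^sub>R r) *\<^sub>R u = (1 - t) *\<^sub>R (x + s *\<^sub>R u) + t *\<^sub>R (x + r *\<^sub>R u)"
    by (simp add: algebra_simps)
  then show "f (x + ((1 - t) *\<^sub>R s + t *\<^sub>R r) *\<^sub>R u) \<le> (1 - t) * f (x + s *\<^sub>R u) + t * f (x + r *\<^sub>R u)"
    using convex_on_UNIV_comb[OF assms, of t "x + s *\<^sub>R u" "x + r *\<^sub>R u"] t by simp
qed simp

text \<open>One step of the Hahn-Banach argument in terms of convex functions. Choose a slope \<open>a\<close> that supports
  \<open>f\<close> on the line through \<open>b\<close> and minimize \<open>f (x + t b) - t a\<close> over \<open>t\<close>. The infimum is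
  convex, lies below \<open>f\<close> and is affine along \<open>b\<close>; directions along which \<open>f\<close> was affine already
  stay so.\<close>

lemma convex_minorant_affine_along:
  fixes f :: "'a::real_vector \<Rightarrow> real"
  assumes cvx: "convex_on UNIV f" and f0: "f 0 = 0"
  shows "\<exists>a q. convex_on UNIV q \<and> q 0 = 0 \<and> (\<forall>x. q x \<le> f x) \<and> (\<forall>x s. q (x + s *\<^sub>R b) = q x + s * a) \<and>
    (\<forall>c a'. (\<forall>x s. f (x + s *\<^sub>R c) = f x + s * a') \<longrightarrow> (\<forall>x s. q (x + s *\<^sub>R c) = q x + s * a'))"
proof -
  define h where "h t = f (t *\<^sub>R b)" for t
  have "convex_on UNIV h" unfolding h_def using convex_on_line[OF cvx, of 0 b] by simp
  from convex_le_Inf_differential[OF this, of 0]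
  have "h 0 + Inf ((\<lambda>t. (h 0 - h t) / (0 - t)) ` ({0<..} \<inter> UNIV)) * (t - 0) \<le> h t" for t by simp
  then obtain a where "\<And>t. h 0 + a * (t - 0) \<le> h t" by blast
  then have a: "\<And>t. h t \<ge> t * a" using f0 by (simp add: h_def mult.commute)
  define k where "k x t = f (x + t *\<^sub>R b) - t * a" for x t
  \<comment> \<open>The midpoint of \<open>x + t b\<close> and \<open>- x + s b\<close> lies on the line through \<open>b\<close>, where the slope \<open>a\<close>
      supports \<open>f\<close>; this keeps the infimum finite.\<close>
  have lower: "- k (- x) s \<le> k x t" for x s t
  proof -
    have "(t + s) / 2 * a \<le> f (((t + s) / 2) *\<^sub>R b)" using a unfolding h_def .
    also have "((t + s) / 2) *\<^sub>R b = (1 - 1/2) *\<^sub>R (x + t *\<^sub>R b) + (1/2) *\<^sub>R (- x + s *\<^sub>R b)"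
      by (simp add: algebra_simps add_divide_distrib)
    also have "f \<dots> \<le> (1 - 1/2) * f (x + t *\<^sub>R b) + 1/2 * f (- x + s *\<^sub>R b)"
      by (rule convex_on_UNIV_comb[OF cvx]) auto
    finally show ?thesis unfolding k_def by (simp add: field_simps)
  qed
  have bdd: "bdd_below (range (k x))" for x
    using lower[of x 0] by (intro bdd_belowI[of _ "- k (- x) 0"]) auto
  define q where "q x = (INF t. k x t)" for x
  have q_le: "q x \<le> k x t" for x t unfolding q_def by (rule cINF_lower[OF bdd]) simp
  have q_ge: "r \<le> q x" if "\<And>t. r \<le> k x t" for r x unfolding q_def by (rule cINF_greatest) (use that in auto)
  have shift: "q (x + s *\<^sub>R b) = q x + s * a" for x s
  proof (rule antisym)
    have "q (x + s *\<^sub>R b) - s * a \<le> q x"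
    proof (rule q_ge)
      fix t show "q (x + s *\<^sub>R b) - s * a \<le> k x t"
        using q_le[of "x + s *\<^sub>R b" "t - s"] by (simp add: k_def algebra_simps)
    qed
    then show "q (x + s *\<^sub>R b) \<le> q x + s * a" by simp
    show "q x + s * a \<le> q (x + s *\<^sub>R b)"
    proof (rule q_ge)
      fix t show "q x + s * a \<le> k (x + s *\<^sub>R b) t"
        using q_le[of x "s + t"] by (simp add: k_def algebra_simps)
    qed
  qed
  have "q 0 \<le> 0" using q_le[of 0 0] f0 by (simp add: k_def)
  moreover have "0 \<le> q 0" using a by (intro q_ge) (simp add: k_def h_def)
  ultimately have q0: "q 0 = 0" by simp
  have "convex_on UNIV q"
  proof (rule convex_onI)
    fix u :: real and x y :: 'a assume u: "0 < u" "u < 1"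
    have *: "q ((1 - u) *\<^sub>R x + u *\<^sub>R y) \<le> (1 - u) * k x t + u * k y s" for t s
    proof -
      have "q ((1 - u) *\<^sub>R x + u *\<^sub>R y) \<le> k ((1 - u) *\<^sub>R x + u *\<^sub>R y) ((1 - u) * t + u * s)" by (rule q_le)
      also have "\<dots> = f ((1 - u) *\<^sub>R (x + t *\<^sub>R b) + u *\<^sub>R (y + s *\<^sub>R b)) - ((1 - u) * t + u * s) * a"
        unfolding k_def by (simp add: algebra_simps)
      also have "\<dots> \<le> (1 - u) * k x t + u * k y s"
        using convex_on_UNIV_comb[OF cvx, of u "x + t *\<^sub>R b" "y + s *\<^sub>R b"] u
        unfolding k_def by (simp add: algebra_simps)
      finally show ?thesis .
    qed
    have "(q ((1 - u) *\<^sub>R x + u *\<^sub>R y) - u * k y s) / (1 - u) \<le> q x" for s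
      by (rule q_ge) (use *[of _ s] u in \<open>simp add: field_simps\<close>)
    then have **: "q ((1 - u) *\<^sub>R x + u *\<^sub>R y) \<le> (1 - u) * q x + u * k y s" for s
      using u by (simp add: field_simps)
    have "(q ((1 - u) *\<^sub>R x + u *\<^sub>R y) - (1 - u) * q x) / u \<le> q y"
      by (rule q_ge) (use ** u in \<open>simp add: field_simps\<close>)
    then show "q ((1 - u) *\<^sub>R x + u *\<^sub>R y) \<le> (1 - u) * q x + u * q y"
      using u by (simp add: field_simps)
  qed simp
  moreover have "q x \<le> f x" for x using q_le[of x 0] by (simp add: k_def)
  moreover have "q (x + s *\<^sub>R c) = q x + s * a'" if c: "\<And>x s. f (x + s *\<^sub>R c) = f x + s * a'" for c a' x s
  proof -
    have kc: "k (x + s *\<^sub>R c) t = k x t + s * a'" for x s t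
      using c[of "x + t *\<^sub>R b" s] unfolding k_def by (simp add: algebra_simps)
    show ?thesis
    proof (rule antisym)
      have "q (x + s *\<^sub>R c) - s * a' \<le> q x"
        by (rule q_ge) (use q_le[of "x + s *\<^sub>R c"] kc in \<open>simp add: algebra_simps\<close>)
      then show "q (x + s *\<^sub>R c) \<le> q x + s * a'" by simp
      show "q x + s * a' \<le> q (x + s *\<^sub>R c)"
        by (rule q_ge) (use q_le[of x] kc in \<open>simp add: algebra_simps\<close>)
    qed
  qed
  ultimately show ?thesis using shift q0 by blast
qed

lemma convex_minorant_affine_along_many:
  fixes f :: "'a::real_vector \<Rightarrow> real" and b :: "nat \<Rightarrow> 'a"
  assumes "convex_on UNIV f" "f 0 = 0"
  shows "\<exists>q a. convex_on UNIV q \<and> q 0 = 0 \<and> (\<forall>x. q x \<le> f x) \<and> (\<forall>i<n. \<forall>x s. q (x + s *\<^sub>R b i) = q x + s * a i)"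
proof (induction n)
  case 0 show ?case using assms by auto
next
  case (Suc n)
  then obtain q a where q: "convex_on UNIV q" "q 0 = 0" "\<And>x. q x \<le> f x"
    and lin: "\<And>i x s. i < n \<Longrightarrow> q (x + s *\<^sub>R b i) = q x + s * a i" by blast
  obtain an q' where q': "convex_on UNIV q'" "q' 0 = 0" "\<And>x. q' x \<le> q x"
    and lin_n: "\<And>x s. q' (x + s *\<^sub>R b n) = q' x + s * an"
    and keep: "\<And>c a' x s. (\<And>x s. q (x + s *\<^sub>R c) = q x + s * a') \<Longrightarrow> q' (x + s *\<^sub>R c) = q' x + s * a'"
    using convex_minorant_affine_along[OF q(1,2), of "b n"] by metis
  have "q' (x + s *\<^sub>R b i) = q' x + s * (a(n := an)) i" if "i < Suc n" for i x s
    using that lin_n keep[OF lin] by (cases "i = n") auto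
  moreover have "q' x \<le> f x" for x using q'(3) q(3) order_trans by blast
  ultimately show ?case using q' by blast
qed

text \<open>After one step per coordinate direction the minorant is linear on the whole space, and a linear
  function of finitely many continuous coordinates is continuous.\<close>

lemma subdifferential_nonempty:
  fixes f :: "'a::real_normed_vector \<Rightarrow> real"
  assumes cs: "coordinate_system n b (\<phi>::nat \<Rightarrow> 'a \<Rightarrow>\<^sub>L real)" and cvx: "convex_on UNIV f"
  shows "\<exists>g. g \<in> subdifferential f x"
proof -
  define F where "F u = f (x + u) - f x" for u
  have "convex_on UNIV F"
  proof (rule convex_onI)
    fix t :: real and u v assume t: "0 < t" "t < 1"
    have "x + ((1 - t) *\<^sub>R u + t *\<^sub>R v) = (1 - t) *\<^sub>R (x + u) + t *\<^sub>R (x + v)" by (simp add: algebra_simps)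
    then show "F ((1 - t) *\<^sub>R u + t *\<^sub>R v) \<le> (1 - t) * F u + t * F v"
      using convex_on_UNIV_comb[OF cvx, of t "x + u" "x + v"] t unfolding F_def by (simp add: algebra_simps)
  qed simp
  moreover have "F 0 = 0" by (simp add: F_def)
  ultimately obtain q a where q: "q 0 = 0" "\<And>u. q u \<le> F u"
    and lin: "\<And>i u s. i < n \<Longrightarrow> q (u + s *\<^sub>R b i) = q u + s * a i"
    using convex_minorant_affine_along_many[of F n b] by blast
  have sums: "m \<le> n \<Longrightarrow> q (\<Sum>i<m. c i *\<^sub>R b i) = (\<Sum>i<m. c i * a i)" for m and c :: "nat \<Rightarrow> real"
    by (induction m) (auto simp: q lin)
  define g where "g = (\<Sum>i<n. a i *\<^sub>R \<phi> i)"
  have "g u = q u" for u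
    using sums[of n "\<lambda>i. \<phi> i u"] unfolding coordinate_system_expand[OF cs] g_def
    by (simp add: blinfun.sum_left blinfun.scaleR_left mult.commute)
  then have "f x + g (y - x) \<le> f y" for y using q(2)[of "y - x"] by (simp add: F_def)
  then show ?thesis unfolding subdifferential_def by blast
qed

text \<open>Supporting affine functions make a convex function lower semicontinuous, which suffices for
  measurability.\<close>

lemma convex_borel_measurable:
  fixes f :: "'a::real_normed_vector \<Rightarrow> real"
  assumes cs: "coordinate_system n b (\<phi>::nat \<Rightarrow> 'a \<Rightarrow>\<^sub>L real)" and cvx: "convex_on UNIV f"
  shows "f \<in> borel_measurable borel"
proof -
  have "open {x. c < f x}" for c
  proof (rule openI)
    fix x assume x: "x \<in> {x. c < f x}"
    obtain g where g: "\<And>y. f x + blinfun_apply g (y - x) \<le> f y"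
      using subdifferential_nonempty[OF cs cvx, of x] unfolding subdifferential_def by auto
    have "continuous_on UNIV (\<lambda>y. f x + blinfun_apply g (y - x))"
      by (intro continuous_intros)
    then have "open {y. c < f x + blinfun_apply g (y - x)}" by (intro open_Collect_less) auto
    moreover have "x \<in> {y. c < f x + blinfun_apply g (y - x)}" using x by simp
    ultimately obtain e where "e > 0" "ball x e \<subseteq> {y. c < f x + blinfun_apply g (y - x)}"
      using open_contains_ball by blast
    then show "\<exists>e>0. ball x e \<subseteq> {x. c < f x}"
      using g by (intro exI[of _ e]) (auto intro: less_le_trans)
  qed
  then show ?thesis by (subst borel_measurable_iff_greater) auto
qed

text \<open>Strong convexity in Jensen form. Unlike the form with subgradients it passes to sums without a sum
  rule for subdifferentials.\<close>

definition uniformly_convex :: "real \<Rightarrow> ('a::real_normed_vector \<Rightarrow> real) \<Rightarrow> bool"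
  where "uniformly_convex m f \<longleftrightarrow> (\<forall>x y t. 0 \<le> t \<and> t \<le> 1 \<longrightarrow>
    f ((1 - t) *\<^sub>R x + t *\<^sub>R y) \<le> (1 - t) * f x + t * f y - m / 2 * (t * (1 - t)) * (norm (x - y))\<^sup>2)"

lemma uniformly_convexD:
  "uniformly_convex m f \<Longrightarrow> 0 \<le> t \<Longrightarrow> t \<le> 1 \<Longrightarrow>
    f ((1 - t) *\<^sub>R x + t *\<^sub>R y) \<le> (1 - t) * f x + t * f y - m / 2 * (t * (1 - t)) * (norm (x - y))\<^sup>2"
  unfolding uniformly_convex_def by blast

text \<open>Average the two subgradient inequalities at the intermediate point \<open>p\<close>; the linear terms cancel.
  A subgradient at \<open>p\<close> exists because the dimension is finite.\<close>

lemma strongly_convex_imp_uniformly_convex: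
  fixes f :: "'a::real_normed_vector \<Rightarrow> real"
  assumes cs: "coordinate_system n b (\<phi>::nat \<Rightarrow> 'a \<Rightarrow>\<^sub>L real)" and sc: "strongly_convex m f"
  shows "uniformly_convex m f"
  unfolding uniformly_convex_def
proof (intro allI impI)
  fix x y :: 'a and t :: real assume t: "0 \<le> t \<and> t \<le> 1"
  define p where "p = (1 - t) *\<^sub>R x + t *\<^sub>R y"
  obtain g where g: "g \<in> subdifferential f p"
    using subdifferential_nonempty[OF cs] sc unfolding strongly_convex_def by blast
  have *: "f u \<ge> f p + g (u - p) + m / 2 * (norm (u - p))\<^sup>2" for u
    using sc g unfolding strongly_convex_def by blast
  have xp: "x - p = t *\<^sub>R (x - y)" and yp: "y - p = (- (1 - t)) *\<^sub>R (x - y)"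
    by (simp_all add: p_def algebra_simps)
  have "(1 - t) * (f p + g (x - p) + m / 2 * (norm (x - p))\<^sup>2) \<le> (1 - t) * f x"
    using *[of x] t by (intro mult_left_mono) auto
  moreover have "t * (f p + g (y - p) + m / 2 * (norm (y - p))\<^sup>2) \<le> t * f y"
    using *[of y] t by (intro mult_left_mono) auto
  moreover have "(1 - t) * (f p + g (x - p) + m / 2 * (norm (x - p))\<^sup>2)
      + t * (f p + g (y - p) + m / 2 * (norm (y - p))\<^sup>2)
    = f p + m / 2 * (t * (1 - t)) * (norm (x - y))\<^sup>2"
    unfolding xp yp norm_scaleR power_mult_distrib blinfun.scaleR_right power2_abs real_scaleR_def
    by (simp add: field_simps power2_eq_square)
  ultimately show "f p \<le> (1 - t) * f x + t * f y - m / 2 * (t * (1 - t)) * (norm (x - y))\<^sup>2"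
    by linarith
qed

lemma uniformly_convex_combination:
  fixes l :: "'a::real_normed_vector \<Rightarrow>\<^sub>L real"
  assumes "uniformly_convex m f" "uniformly_convex r h" "0 \<le> A" "0 \<le> B"
  shows "uniformly_convex (A * m + B * r) (\<lambda>x. l x + A * f x + B * h x)"
  unfolding uniformly_convex_def
proof (intro allI impI)
  fix x y :: 'a and t :: real assume t: "0 \<le> t \<and> t \<le> 1"
  define p where "p = (1 - t) *\<^sub>R x + t *\<^sub>R y"
  have "A * f p \<le> A * ((1 - t) * f x + t * f y - m / 2 * (t * (1 - t)) * (norm (x - y))\<^sup>2)"
    using uniformly_convexD[OF assms(1), of t x y] t assms(3) by (intro mult_left_mono) (auto simp: p_def)
  moreover have "B * h p \<le> B * ((1 - t) * h x + t * h y - r / 2 * (t * (1 - t)) * (norm (x - y))\<^sup>2)"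
    using uniformly_convexD[OF assms(2), of t x y] t assms(4) by (intro mult_left_mono) (auto simp: p_def)
  moreover have "l p = (1 - t) * l x + t * l y"
    by (simp add: p_def blinfun.add_right blinfun.scaleR_right)
  ultimately have "l p + A * f p + B * h p
    \<le> (1 - t) * (l x + A * f x + B * h x) + t * (l y + A * f y + B * h y)
      - (A * m + B * r) / 2 * (t * (1 - t)) * (norm (x - y))\<^sup>2"
    by (simp add: field_simps)
  then show "l ((1 - t) *\<^sub>R x + t *\<^sub>R y) + A * f ((1 - t) *\<^sub>R x + t *\<^sub>R y) + B * h ((1 - t) *\<^sub>R x + t *\<^sub>R y)
    \<le> (1 - t) * (l x + A * f x + B * h x) + t * (l y + A * f y + B * h y)
      - (A * m + B * r) / 2 * (t * (1 - t)) * (norm (x - y))\<^sup>2" unfolding p_def .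
qed

lemma is_arg_min_UNIV: "is_arg_min f (\<lambda>_. True) z \<longleftrightarrow> (\<forall>x. f z \<le> (f x :: real))"
  by (auto simp: is_arg_min_def not_less)

text \<open>Compare \<open>z\<close> with points on the segment to \<open>x\<close> and let them tend to \<open>z\<close>.\<close>

lemma uniformly_convex_growth:
  assumes uc: "uniformly_convex m f" and z: "is_arg_min f (\<lambda>_. True) z"
  shows "f z + m / 2 * (norm (x - z))\<^sup>2 \<le> f x"
proof -
  have *: "f z + (1 - t) * (m / 2 * (norm (x - z))\<^sup>2) \<le> f x" if t: "0 < t" "t < 1" for t
  proof -
    have "f z \<le> f ((1 - t) *\<^sub>R z + t *\<^sub>R x)" using z by (simp add: is_arg_min_UNIV)
    also have "\<dots> \<le> (1 - t) * f z + t * f x - m / 2 * (t * (1 - t)) * (norm (z - x))\<^sup>2"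
      using uniformly_convexD[OF uc] t by simp
    finally have "t * (f z + (1 - t) * (m / 2 * (norm (x - z))\<^sup>2)) \<le> t * f x"
      by (simp add: algebra_simps norm_minus_commute)
    then show ?thesis using t by simp
  qed
  have "((\<lambda>t. f z + (1 - t) * (m / 2 * (norm (x - z))\<^sup>2)) \<longlongrightarrow> f z + (1 - 0) * (m / 2 * (norm (x - z))\<^sup>2)) (at_right 0)"
    by (intro tendsto_intros)
  moreover have "\<forall>\<^sub>F t in at_right 0. f z + (1 - t) * (m / 2 * (norm (x - z))\<^sup>2) \<le> f x"
    using * by (auto simp: eventually_at_right_field intro!: exI[of _ 1])
  ultimately have "f z + (1 - 0) * (m / 2 * (norm (x - z))\<^sup>2) \<le> f x"
    by (rule tendsto_upperbound) simp
  then show ?thesis by simp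
qed

text \<open>Add the quadratic growth inequalities of the two minimizers at each other.\<close>

lemma arg_min_lipschitz:
  fixes l l' :: "'a::real_normed_vector \<Rightarrow>\<^sub>L real"
  assumes m: "m > 0"
    and uc: "\<And>l::'a \<Rightarrow>\<^sub>L real. uniformly_convex m (\<lambda>x. l x + f x)"
    and z: "is_arg_min (\<lambda>x. l x + f x) (\<lambda>_. True) z"
    and z': "is_arg_min (\<lambda>x. l' x + f x) (\<lambda>_. True) z'"
  shows "norm (z - z') \<le> norm (l - l') / m"
proof -
  have "(l z + f z) + m / 2 * (norm (z' - z))\<^sup>2 \<le> l z' + f z'"
    by (rule uniformly_convex_growth[OF uc z])
  moreover have "(l' z' + f z') + m / 2 * (norm (z - z'))\<^sup>2 \<le> l' z + f z"
    by (rule uniformly_convex_growth[OF uc z'])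
  ultimately have "m * (norm (z - z'))\<^sup>2 \<le> (l - l') (z' - z)"
    by (simp add: norm_minus_commute blinfun.diff_left blinfun.diff_right)
  also have "\<dots> \<le> norm (l - l') * norm (z - z')"
    using norm_blinfun[of "l - l'" "z' - z"] by (simp add: norm_minus_commute)
  finally have "norm (z - z') * (m * norm (z - z')) \<le> norm (z - z') * norm (l - l')"
    by (simp add: power2_eq_square mult.commute mult.left_commute)
  then show ?thesis using m by (cases "z = z'") (auto simp: field_simps)
qed

section \<open>Gradients of smooth convex functions\<close>

lemma grad_has_derivative:
  assumes "smooth_wrt_norm L G"
  shows "(G has_derivative blinfun_apply (grad G x)) (at x)"
proof -
  have "G differentiable at x" using assms by (simp add: smooth_wrt_norm_def)
  then have *: "(G has_derivative frechet_derivative G (at x)) (at x)" by (simp add: frechet_derivative_works)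
  then show ?thesis unfolding grad_def
    by (simp add: bounded_linear_Blinfun_apply[OF has_derivative_bounded_linear])
qed

lemma grad_lipschitz:
  assumes "smooth_wrt_norm L G"
  shows "norm (grad G x - grad G y) \<le> L * norm (x - y)"
  using assms by (simp add: smooth_wrt_norm_def)

lemma has_field_derivative_along_line:
  assumes "smooth_wrt_norm L G"
  shows "((\<lambda>t. G (x + t *\<^sub>R u)) has_field_derivative grad G (x + t *\<^sub>R u) u) (at t)"
proof -
  have "((\<lambda>t. x + t *\<^sub>R u) has_derivative (\<lambda>h. h *\<^sub>R u)) (at t)"
    by (auto intro!: derivative_eq_intros)
  then have "((\<lambda>t. G (x + t *\<^sub>R u)) has_derivative (\<lambda>h. grad G (x + t *\<^sub>R u) (h *\<^sub>R u))) (at t)"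
    by (rule has_derivative_compose) (rule grad_has_derivative[OF assms])
  moreover have "(\<lambda>h. grad G (x + t *\<^sub>R u) (h *\<^sub>R u)) = (*) (grad G (x + t *\<^sub>R u) u)"
    by (simp add: fun_eq_iff blinfun.scaleR_right mult.commute)
  ultimately show ?thesis by (simp only: has_field_derivative_def)
qed

lemma convex_above_tangent:
  assumes "smooth_wrt_norm L G" "convex_on UNIV G"
  shows "G x + grad G x (y - x) \<le> G y"
proof -
  have "(grad G (x + 0 *\<^sub>R (y - x)) (y - x)) * (1 - 0) \<le> G (x + 1 *\<^sub>R (y - x)) - G (x + 0 *\<^sub>R (y - x))"
    by (rule convex_on_imp_above_tangent[OF convex_on_line[OF assms(2), of x "y - x"], of 0 1])
       (use has_field_derivative_along_line[OF assms(1), of x "y - x" 0] in simp_all)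
  then show ?thesis by simp
qed

text \<open>Along the segment, the excess of \<open>G\<close> over the quadratic upper model has nonpositive derivative by
  the Lipschitz condition on the gradient.\<close>

lemma smooth_descent:
  assumes sm: "smooth_wrt_norm L G"
  shows "G y \<le> G x + grad G x (y - x) + L / 2 * (norm (y - x))\<^sup>2"
proof -
  define u where "u = y - x"
  define h where "h t = G (x + t *\<^sub>R u) - t * grad G x u - L / 2 * t\<^sup>2 * (norm u)\<^sup>2" for t
  have "h 1 \<le> h 0"
  proof (rule DERIV_nonpos_imp_nonincreasing[of 0 1 h])
    fix t :: real assume t: "0 \<le> t" "t \<le> 1"
    have "((\<lambda>t. t * c) has_field_derivative c) (at t)" for c :: real
      by (auto intro!: derivative_eq_intros)
    moreover have "((\<lambda>t. L / 2 * t\<^sup>2 * c) has_field_derivative L * t * c) (at t)" for c :: real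
      by (auto intro!: derivative_eq_intros)
    ultimately have "(h has_field_derivative (grad G (x + t *\<^sub>R u) u - grad G x u - L * t * (norm u)\<^sup>2)) (at t)"
      unfolding h_def by (intro DERIV_diff has_field_derivative_along_line[OF sm])
    moreover have "grad G (x + t *\<^sub>R u) u - grad G x u \<le> L * t * (norm u)\<^sup>2"
    proof -
      have "grad G (x + t *\<^sub>R u) u - grad G x u \<le> norm (grad G (x + t *\<^sub>R u) - grad G x) * norm u"
        using norm_blinfun[of "grad G (x + t *\<^sub>R u) - grad G x" u] by (simp add: blinfun.diff_left)
      also have "\<dots> \<le> (L * norm (t *\<^sub>R u)) * norm u"
        using grad_lipschitz[OF sm, of "x + t *\<^sub>R u" x] by (intro mult_right_mono) auto
      finally show ?thesis using t by (simp add: power2_eq_square mult.assoc)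
    qed
    ultimately show "\<exists>y. (h has_field_derivative y) (at t) \<and> y \<le> 0" by force
  qed simp
  then show ?thesis by (simp add: h_def u_def)
qed

section \<open>Growth of the weights\<close>

text \<open>Beyond the first weight, everything follows from monotonicity and the quadratic equation for the
  weights; the explicit square root would only obscure it.\<close>

declare scm_A.simps(2) [simp del]

text \<open>The recursion picks the larger root of a quadratic equation. Divided by \<open>A1\<close>, the equation says that the
  strong convexity modulus \<open>\<beta> * \<nu> + \<mu> * A0\<close> of the accumulated model exceeds the smoothness cost
  \<open>\<beta> * (A1 - A0)\<^sup>2 / A1\<close> of the step by exactly \<open>sqrt (\<mu> * \<beta>) * (A1 - A0)\<close>. This surplus is what absorbs
  the gradient noise.\<close>

lemma scm_A_Suc:
  assumes pos: "\<beta> > 0" "\<mu> > 0" "\<nu> > 0" and A: "scm_A \<beta> \<mu> \<nu> k \<ge> 0"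
  defines "A0 \<equiv> scm_A \<beta> \<mu> \<nu> k" and "A1 \<equiv> scm_A \<beta> \<mu> \<nu> (Suc k)"
  shows scm_A_increment_equation:
      "\<beta> * (A1 - A0)\<^sup>2 + sqrt (\<mu> * \<beta>) * A1 * (A1 - A0) = (\<beta> * \<nu> + \<mu> * A0) * A1"
    and scm_A_strict_step: "A0 < A1"
proof -
  define s where "s = sqrt (\<mu> * \<beta>)"
  have s: "s > 0" "s\<^sup>2 = \<mu> * \<beta>" using pos by (simp_all add: s_def)
  have A0: "A0 \<ge> 0" using A by (simp add: A0_def)
  define p where "p = A0 * (\<mu> + 2 * \<beta> + s) + \<beta> * \<nu>"
  define D where "D = (\<beta> * \<nu> + \<mu> * A0)\<^sup>2 + 4 * A0 * \<beta>\<^sup>2 * \<nu> + 5 * A0\<^sup>2 * \<mu> * \<beta>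
      + 2 * A0 * s * (\<beta> * \<nu> + A0 * \<mu>)"
  have "A1 = (p + sqrt D) / (2 * (\<beta> + s))"
    unfolding A1_def p_def D_def s_def A0_def by (simp add: scm_A.simps(2) Let_def)
  then have A1: "2 * (\<beta> + s) * A1 = p + sqrt D" using s pos by (simp add: field_simps)
  \<comment> \<open>With \<open>A0 * \<mu> + \<beta> * \<nu> > 0\<close>, the bound \<open>s * A0 \<le> sqrt D\<close> forces strict growth.\<close>
  have "5 * A0\<^sup>2 * \<mu> * \<beta> \<le> D" unfolding D_def using pos s A0 by (simp add: add_nonneg_nonneg)
  moreover have "5 * A0\<^sup>2 * \<mu> * \<beta> = 5 * (s * A0)\<^sup>2" by (simp add: power_mult_distrib s)
  ultimately have sA: "(s * A0)\<^sup>2 \<le> D" using zero_le_power2[of "s * A0"] by linarith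
  then have "s * A0 \<le> sqrt D" by (rule real_le_rsqrt)
  then have "2 * (\<beta> + s) * A0 < 2 * (\<beta> + s) * A1"
    unfolding A1 p_def using pos s A0 mult_pos_pos[of \<beta> \<nu>] mult_nonneg_nonneg[of A0 \<mu>] \<open>s * A0 \<le> sqrt D\<close>
    by (simp only: algebra_simps) linarith
  then show "A0 < A1" using pos s by simp
  have D0: "D \<ge> 0" using sA zero_le_power2[of "s * A0"] by linarith
  have "(2 * (\<beta> + s) * A1 - p)\<^sup>2 = D" unfolding A1 using D0 by simp
  moreover have "D = p\<^sup>2 - 4 * (\<beta> + s) * (\<beta> * A0\<^sup>2)"
    using s(2) unfolding D_def p_def by algebra
  moreover have "4 * (\<beta> + s) * ((\<beta> + s) * A1\<^sup>2 - p * A1 + \<beta> * A0\<^sup>2)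
      = (2 * (\<beta> + s) * A1 - p)\<^sup>2 - (p\<^sup>2 - 4 * (\<beta> + s) * (\<beta> * A0\<^sup>2))" by algebra
  ultimately have "4 * (\<beta> + s) * ((\<beta> + s) * A1\<^sup>2 - p * A1 + \<beta> * A0\<^sup>2) = 0" by simp
  then have "(\<beta> + s) * A1\<^sup>2 - p * A1 + \<beta> * A0\<^sup>2 = 0" using pos s by simp
  then show "\<beta> * (A1 - A0)\<^sup>2 + sqrt (\<mu> * \<beta>) * A1 * (A1 - A0) = (\<beta> * \<nu> + \<mu> * A0) * A1"
    unfolding s_def[symmetric] p_def by algebra
qed

lemma scm_A_nonneg:
  assumes "\<beta> > 0" "\<mu> > 0" "\<nu> > 0"
  shows "scm_A \<beta> \<mu> \<nu> k \<ge> 0"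
proof (induction k)
  case (Suc k) then show ?case using scm_A_strict_step[OF assms] by (meson less_eq_real_def order_trans)
qed simp

lemma scm_A_one:
  assumes "\<beta> > 0" "\<mu> > 0" "\<nu> > 0"
  shows "scm_A \<beta> \<mu> \<nu> 1 = \<nu> * sqrt \<beta> / (sqrt \<beta> + sqrt \<mu>)"
proof -
  have "scm_A \<beta> \<mu> \<nu> 1 = 2 * (\<beta> * \<nu>) / (2 * (\<beta> + sqrt (\<mu> * \<beta>)))"
    using assms by (simp add: scm_A.simps(2) Let_def)
  also have "\<beta> + sqrt (\<mu> * \<beta>) = sqrt \<beta> * (sqrt \<beta> + sqrt \<mu>)"
    using assms by (simp add: real_sqrt_mult algebra_simps)
  also have "2 * (\<beta> * \<nu>) = 2 * (sqrt \<beta> * sqrt \<beta> * \<nu>)" using assms by simp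
  also have "2 * (sqrt \<beta> * sqrt \<beta> * \<nu>) / (2 * (sqrt \<beta> * (sqrt \<beta> + sqrt \<mu>))) = \<nu> * sqrt \<beta> / (sqrt \<beta> + sqrt \<mu>)"
  proof -
    have "sqrt \<beta> > 0" "sqrt \<mu> > 0" using assms by simp_all
    moreover have "2 * (r * r * \<nu>) / (2 * (r * (r + t))) = \<nu> * r / (r + t)" if "r > 0" "t > 0" for r t :: real
      using that by (simp add: divide_simps)
    ultimately show ?thesis by blast
  qed
  finally show ?thesis .
qed

text \<open>If the increment were smaller than \<open>\<rho> / 2 * A0\<close>, the two terms on the left of the quadratic equation
  would be at most one quarter and one half of \<open>\<mu> * A0 * A1\<close>.\<close>

lemma scm_A_growth_step:
  assumes pos: "\<beta> > 0" "\<mu> > 0" "\<nu> > 0" 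
  defines "\<rho> \<equiv> sqrt \<mu> / (sqrt \<beta> + sqrt \<mu>)"
  shows "(1 + \<rho> / 2) * scm_A \<beta> \<mu> \<nu> k \<le> scm_A \<beta> \<mu> \<nu> (Suc k)"
proof (rule ccontr)
  define A0 where "A0 = scm_A \<beta> \<mu> \<nu> k"
  define A1 where "A1 = scm_A \<beta> \<mu> \<nu> (Suc k)"
  define a where "a = A1 - A0"
  define b m where "b = sqrt \<beta>" and "m = sqrt \<mu>"
  have bm: "b > 0" "m > 0" "\<beta> = b\<^sup>2" "\<mu> = m\<^sup>2" "sqrt (\<mu> * \<beta>) = m * b"
    using pos by (auto simp: b_def m_def real_sqrt_mult)
  have A0: "A0 \<ge> 0" unfolding A0_def by (rule scm_A_nonneg[OF pos])
  have lt: "A0 < A1" using scm_A_strict_step[OF pos] A0 by (simp add: A0_def A1_def)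
  have eq: "b\<^sup>2 * a\<^sup>2 + m * b * A1 * a = (b\<^sup>2 * \<nu> + m\<^sup>2 * A0) * A1"
    using scm_A_increment_equation[OF pos, of k] A0 bm by (simp add: A0_def A1_def a_def)
  assume "\<not> (1 + \<rho> / 2) * scm_A \<beta> \<mu> \<nu> k \<le> scm_A \<beta> \<mu> \<nu> (Suc k)"
  then have "a < \<rho> / 2 * A0" by (simp add: A0_def A1_def a_def algebra_simps)
  moreover have \<rho>: "b * \<rho> \<le> m" "\<rho> \<le> 1" "0 < \<rho>" using bm unfolding \<rho>_def b_def[symmetric] m_def[symmetric]
    by (auto simp: field_simps add_pos_pos)
  ultimately have "b * a \<le> b * (\<rho> / 2 * A0)" using bm by (intro mult_left_mono) auto
  also have "\<dots> \<le> m / 2 * A0" using mult_right_mono[OF \<rho>(1) A0] by simp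
  finally have ba: "b * a \<le> m / 2 * A0" .
  have a0: "a > 0" using lt by (simp add: a_def)
  have "b\<^sup>2 * a\<^sup>2 = (b * a) * (b * a)" by (simp add: power2_eq_square)
  also have "\<dots> \<le> (m / 2 * A0) * (m / 2 * A0)" using a0 bm A0 by (intro mult_mono[OF ba ba]) auto
  also have "\<dots> \<le> (m / 2 * A0) * (m / 2 * A1)" using bm A0 lt by (intro mult_left_mono) auto
  finally have 1: "b\<^sup>2 * a\<^sup>2 \<le> m\<^sup>2 * A0 * A1 / 4" by (simp add: power2_eq_square field_simps)
  have 2: "m * b * A1 * a \<le> m\<^sup>2 * A0 * A1 / 2"
    using mult_left_mono[OF ba, of "m * A1"] bm A0 lt by (simp add: power2_eq_square field_simps)
  have "b\<^sup>2 * \<nu> * A1 > 0" "m\<^sup>2 * A0 * A1 \<ge> 0" using bm pos A0 lt by auto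
  with eq 1 2 show False by (simp add: algebra_simps)
qed

text \<open>The growth factor \<open>1 + \<rho> / 2\<close> dominates \<open>exp (\<rho> / 4)\<close> because \<open>\<rho> / 4 \<le> 1\<close>.\<close>

lemma scm_A_lower_bound:
  assumes pos: "\<beta> > 0" "\<mu> > 0" "\<nu> > 0"
  shows "scm_A \<beta> \<mu> \<nu> (Suc k) \<ge>
    \<nu> * sqrt \<beta> / (sqrt \<beta> + sqrt \<mu>) * exp (real k * sqrt \<mu> / (4 * (sqrt \<beta> + sqrt \<mu>)))"
proof (induction k)
  case 0 show ?case using scm_A_one[OF pos] by simp
next
  case (Suc k)
  define \<rho> where "\<rho> = sqrt \<mu> / (sqrt \<beta> + sqrt \<mu>)"
  have sq: "sqrt \<beta> > 0" "sqrt \<mu> > 0" using pos by auto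
  then have \<rho>: "0 \<le> \<rho> / 4" "\<rho> / 4 \<le> 1" by (auto simp: \<rho>_def field_simps add_pos_pos)
  have "exp (\<rho> / 4) \<le> 1 + \<rho> / 4 + (\<rho> / 4)\<^sup>2" by (rule exp_bound[OF \<rho>])
  also have "(\<rho> / 4)\<^sup>2 \<le> \<rho> / 4" using \<rho> by (simp only: power2_eq_square mult_left_le)
  finally have e: "exp (\<rho> / 4) \<le> 1 + \<rho> / 2" by simp
  define C where "C = \<nu> * sqrt \<beta> / (sqrt \<beta> + sqrt \<mu>)"
  have "real (Suc k) * sqrt \<mu> / (4 * (sqrt \<beta> + sqrt \<mu>)) = \<rho> / 4 + real k * sqrt \<mu> / (4 * (sqrt \<beta> + sqrt \<mu>))"
    by (simp add: \<rho>_def algebra_simps add_divide_distrib)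
  then have "C * exp (real (Suc k) * sqrt \<mu> / (4 * (sqrt \<beta> + sqrt \<mu>)))
      = exp (\<rho> / 4) * (C * exp (real k * sqrt \<mu> / (4 * (sqrt \<beta> + sqrt \<mu>))))"
    by (simp add: exp_add)
  also have "\<dots> \<le> (1 + \<rho> / 2) * scm_A \<beta> \<mu> \<nu> (Suc k)"
    using Suc.IH e \<rho> sq pos unfolding C_def by (intro mult_mono) auto
  also have "\<dots> \<le> scm_A \<beta> \<mu> \<nu> (Suc (Suc k))"
    unfolding \<rho>_def by (rule scm_A_growth_step[OF pos])
  finally show ?case by (simp add: C_def)
qed

section \<open>The bound along one run\<close>

lemma scm_runD:
  assumes "scm_run \<beta> \<mu> \<nu> H w y0 g y z v d"
  shows "is_arg_min w (\<lambda>_. True) y0" "z 0 = y0" "y 0 = y0" "d 0 = 0"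
    "v k = (1 - scm_tau \<beta> \<mu> \<nu> k) *\<^sub>R y k + scm_tau \<beta> \<mu> \<nu> k *\<^sub>R z k"
    "d (Suc k) = d k + (scm_A \<beta> \<mu> \<nu> (Suc k) - scm_A \<beta> \<mu> \<nu> k) *\<^sub>R g k"
    "y (Suc k) = (1 - scm_tau \<beta> \<mu> \<nu> k) *\<^sub>R y k + scm_tau \<beta> \<mu> \<nu> k *\<^sub>R z (Suc k)"
  using assms unfolding scm_run_def Let_def by blast+

text \<open>At \<open>k = 0\<close> the objective is \<open>\<beta> * w\<close>, whose minimizer is the starting point.\<close>

lemma scm_run_arg_min:
  assumes "scm_run \<beta> \<mu> \<nu> H w y0 g y z v d" and "\<beta> > 0"
  shows "is_arg_min (\<lambda>x. d k x + scm_A \<beta> \<mu> \<nu> k * H x + \<beta> * w x) (\<lambda>_. True) (z k)"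
proof (cases k)
  case 0
  then show ?thesis using scm_runD(1,2,4)[OF assms(1)] \<open>\<beta> > 0\<close> by (simp add: is_arg_min_UNIV)
next
  case (Suc j)
  then show ?thesis using assms(1) unfolding scm_run_def Let_def by blast
qed

text \<open>The new point \<open>y'\<close> pays the smoothness cost of moving by
  \<open>\<tau> * norm (z' - z)\<close>, the accumulated model gains quadratically in \<open>norm (z' - z)\<close>, and by \<open>quad\<close> the
  gain exceeds the cost by \<open>s * (A1 - A0) / 2\<close> times the squared distance. That remainder absorbs the
  pairing of the noise with the displacement by Young's inequality, which leaves the noise paired with the old
  minimizer \<open>z\<close>; this pairing has mean zero.\<close>

lemma composite_dual_averaging_step:
  fixes G H w :: "'a::real_normed_vector \<Rightarrow> real" and d g :: "'a \<Rightarrow>\<^sub>L real"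
  assumes G: "convex_on UNIV G" "smooth_wrt_norm \<beta> G"
    and H: "uniformly_convex \<mu> H" and w: "uniformly_convex \<nu> w"
    and pos: "\<beta> > 0" "\<mu> > 0" "s > 0" and A: "0 \<le> A0" "A0 < A1"
    and quad: "\<beta> * (A1 - A0)\<^sup>2 + s * A1 * (A1 - A0) = (\<beta> * \<nu> + \<mu> * A0) * A1"
    and z: "is_arg_min (\<lambda>x. d x + A0 * H x + \<beta> * w x) (\<lambda>_. True) z"
    and \<tau>: "\<tau> = 1 - A0 / A1"
    and v: "v = (1 - \<tau>) *\<^sub>R y + \<tau> *\<^sub>R z" and y': "y' = (1 - \<tau>) *\<^sub>R y + \<tau> *\<^sub>R z'"
    and d': "d' = d + (A1 - A0) *\<^sub>R g"
  defines "\<delta> \<equiv> g - grad G v"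
  shows "A1 * (G y' + H y') + (d z + A0 * H z + \<beta> * w z) \<le>
    A0 * (G y + H y) + (d' z' + A1 * H z' + \<beta> * w z') + (A1 - A0) * (G v - grad G v v)
    - (A1 - A0) * (\<delta> z - (norm \<delta>)\<^sup>2 / (2 * s))"
proof -
  define a r where "a = A1 - A0" and "r = norm (z' - z)"
  have a: "a > 0" and A1: "A1 > 0" using A by (auto simp: a_def)
  have \<tau>A: "A1 * \<tau> = a" "A1 * (1 - \<tau>) = A0" "0 \<le> \<tau>" "\<tau> \<le> 1"
    using A A1 unfolding \<tau> a_def by (auto simp: field_simps)
  have "uniformly_convex (A0 * \<mu> + \<beta> * \<nu>) (\<lambda>x. d x + A0 * H x + \<beta> * w x)"
    using A pos by (intro uniformly_convex_combination H w) auto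
  then have growth: "(d z + A0 * H z + \<beta> * w z) + (\<beta> * \<nu> + \<mu> * A0) / 2 * r\<^sup>2 \<le> d z' + A0 * H z' + \<beta> * w z'"
    using uniformly_convex_growth[OF _ z, of "A0 * \<mu> + \<beta> * \<nu>" z'] unfolding r_def by (simp add: ac_simps)
  have "y' - v = \<tau> *\<^sub>R (z' - z)" by (simp add: y' v algebra_simps)
  then have nrm: "norm (y' - v) = \<tau> * r" using \<tau>A by (simp add: r_def)
  have "A1 * G y' \<le> A1 * (G v + grad G v (y' - v) + \<beta> / 2 * (\<tau> * r)\<^sup>2)"
    using smooth_descent[OF G(2), of y' v] A1 nrm by (intro mult_left_mono) auto
  also have "\<dots> = A0 * (G v + grad G v (y - v)) + a * (G v + grad G v (z' - v)) + \<beta> / 2 * (A1 * \<tau>\<^sup>2) * r\<^sup>2"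
  proof -
    have "y' - v = (1 - \<tau>) *\<^sub>R (y - v) + \<tau> *\<^sub>R (z' - v)" by (simp add: y' algebra_simps)
    then have "grad G v (y' - v) = (1 - \<tau>) * grad G v (y - v) + \<tau> * grad G v (z' - v)"
      by (simp add: blinfun.add_right blinfun.scaleR_right)
    then show ?thesis unfolding \<tau>A(1,2)[symmetric] by (simp only:) (simp add: algebra_simps power2_eq_square)
  qed
  also have "\<beta> / 2 * (A1 * \<tau>\<^sup>2) * r\<^sup>2 = ((\<beta> * \<nu> + \<mu> * A0) - s * a) / 2 * r\<^sup>2"
  proof -
    have "A1 * (\<beta> * (A1 * \<tau>\<^sup>2)) = \<beta> * a\<^sup>2" unfolding \<tau>A(1)[symmetric] by (simp add: power2_eq_square)
    also have "\<dots> = A1 * ((\<beta> * \<nu> + \<mu> * A0) - s * a)" using quad unfolding a_def by (simp add: algebra_simps)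
    finally have "\<beta> * (A1 * \<tau>\<^sup>2) = (\<beta> * \<nu> + \<mu> * A0) - s * a" using A1 by simp
    moreover have "\<beta> / 2 * (A1 * \<tau>\<^sup>2) * r\<^sup>2 = \<beta> * (A1 * \<tau>\<^sup>2) / 2 * r\<^sup>2" by simp
    ultimately show ?thesis by (simp only:)
  qed
  also have "A0 * (G v + grad G v (y - v)) \<le> A0 * G y"
    using convex_above_tangent[OF G(2,1)] A by (intro mult_left_mono) auto
  finally have Gy: "A1 * G y' \<le> A0 * G y + a * (G v + grad G v (z' - v))
      + ((\<beta> * \<nu> + \<mu> * A0) - s * a) / 2 * r\<^sup>2" by simp
  have "H y' \<le> (1 - \<tau>) * H y + \<tau> * H z' - \<mu> / 2 * (\<tau> * (1 - \<tau>)) * (norm (y - z'))\<^sup>2"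
    unfolding y' using \<tau>A by (intro uniformly_convexD[OF H]) auto
  also have "\<dots> \<le> (1 - \<tau>) * H y + \<tau> * H z'" using \<tau>A pos by simp
  finally have "A1 * H y' \<le> A1 * ((1 - \<tau>) * H y + \<tau> * H z')" using A1 by simp
  then have Hy: "A1 * H y' \<le> A0 * H y + a * H z'"
    unfolding \<tau>A(1,2)[symmetric] by (simp add: algebra_simps)
  have "\<delta> z - \<delta> z' \<le> norm \<delta> * r"
    using norm_blinfun[of \<delta> "z - z'"] by (simp add: blinfun.diff_right r_def norm_minus_commute)
  also have "\<dots> \<le> s / 2 * r\<^sup>2 + (norm \<delta>)\<^sup>2 / (2 * s)"
    using zero_le_power2[of "s * r - norm \<delta>"] pos by (simp add: field_simps power2_eq_square)
  finally have "a * (\<delta> z - \<delta> z') \<le> a * (s / 2 * r\<^sup>2 + (norm \<delta>)\<^sup>2 / (2 * s))"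
    using a by (intro mult_left_mono) auto
  then have noise: "a * (\<delta> z - \<delta> z') \<le> s * a / 2 * r\<^sup>2 + a * ((norm \<delta>)\<^sup>2 / (2 * s))"
    by (simp add: algebra_simps)
  have dz: "d' z' = d z' + a * grad G v z' + a * \<delta> z'"
    by (simp add: d' \<delta>_def a_def[symmetric] blinfun.add_left blinfun.scaleR_left blinfun.diff_left algebra_simps)
  have AH: "A1 * H z' = A0 * H z' + a * H z'" by (simp add: a_def algebra_simps)
  have gz: "a * (G v + grad G v (z' - v)) = a * (G v - grad G v v) + a * grad G v z'"
    by (simp add: blinfun.diff_right algebra_simps)
  have split: "((\<beta> * \<nu> + \<mu> * A0) - s * a) / 2 * r\<^sup>2 = (\<beta> * \<nu> + \<mu> * A0) / 2 * r\<^sup>2 - s * a / 2 * r\<^sup>2"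
    by (simp add: algebra_simps diff_divide_distrib)
  \<comment> \<open>Only the linear structure of these blocks matters for the final combination.\<close>
  have combine: "X1 + X2 + P \<le> Y1 + Y2 + (Q + h + e) + c - (u - N)"
    if "P + m \<le> Q" "X1 \<le> Y1 + (c + l) + (m - q)" "X2 \<le> Y2 + h" "u - u' \<le> q + N" "e = l + u'"
    for X1 X2 P Y1 Y2 Q h e c u u' N m l q :: real
    using that by linarith
  have "A1 * G y' + A1 * H y' + (d z + A0 * H z + \<beta> * w z) \<le>
    A0 * G y + A0 * H y + ((d z' + A0 * H z' + \<beta> * w z') + a * H z' + (a * grad G v z' + a * \<delta> z'))
      + a * (G v - grad G v v) - (a * \<delta> z - a * ((norm \<delta>)\<^sup>2 / (2 * s)))"
    by (rule combine[OF growth Gy[unfolded gz split] Hy noise[unfolded right_diff_distrib] refl])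
  then show ?thesis unfolding dz AH a_def[symmetric] by (simp only: algebra_simps)
qed

text \<open>Telescoping the step inequality bounds \<open>A k * F (y k)\<close> by the minimum of the accumulated model, which is at
  most its value at the comparison point \<open>x\<close>. There the tangents of \<open>G\<close> lie below \<open>G x\<close>, and only noise terms
  remain.\<close>

lemma scm_pathwise_bound:
  fixes G H w :: "'a::real_normed_vector \<Rightarrow> real"
  assumes G: "convex_on UNIV G" "smooth_wrt_norm \<beta> G"
    and H: "uniformly_convex \<mu> H" and w: "uniformly_convex \<nu> w"
    and pos: "\<beta> > 0" "\<mu> > 0" "\<nu> > 0"
    and run: "scm_run \<beta> \<mu> \<nu> H w y0 g y z v d"
  defines "A \<equiv> scm_A \<beta> \<mu> \<nu>" and "\<delta> \<equiv> \<lambda>i. g i - grad G (v i)"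
  shows "A k * ((G (y k) + H (y k)) - (G x + H x)) \<le> \<beta> * (w x - w y0) +
    (\<Sum>i<k. (A (Suc i) - A i) * (\<delta> i (x - z i) + (norm (\<delta> i))\<^sup>2 / (2 * sqrt (\<mu> * \<beta>))))"
proof -
  let ?s = "sqrt (\<mu> * \<beta>)"
  define c where "c k = (\<Sum>i<k. (A (Suc i) - A i) * (G (v i) - grad G (v i) (v i)))" for k
  define e where "e k = (\<Sum>i<k. (A (Suc i) - A i) * (\<delta> i (z i) - (norm (\<delta> i))\<^sup>2 / (2 * ?s)))" for k
  have A0: "A i \<ge> 0" for i unfolding A_def by (rule scm_A_nonneg[OF pos])
  have lt: "A i < A (Suc i)" for i
    using scm_A_strict_step[OF pos, of i] A0[of i] unfolding A_def .
  have s: "?s > 0" using pos by simp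
  \<comment> \<open>The estimate sequence invariant: \<open>c\<close> collects the constant parts of the tangents and \<open>e\<close> the
      noise.\<close>
  have lower: "A k * (G (y k) + H (y k)) + \<beta> * w y0 \<le> (d k (z k) + A k * H (z k) + \<beta> * w (z k)) + c k - e k" for k
  proof (induction k)
    case 0
    then show ?case using scm_runD(2,4)[OF run] by (simp add: c_def e_def A_def)
  next
    case (Suc k)
    have "A (Suc k) * (G (y (Suc k)) + H (y (Suc k))) + (d k (z k) + A k * H (z k) + \<beta> * w (z k)) \<le>
      A k * (G (y k) + H (y k)) + (d (Suc k) (z (Suc k)) + A (Suc k) * H (z (Suc k)) + \<beta> * w (z (Suc k)))
      + (A (Suc k) - A k) * (G (v k) - grad G (v k) (v k))
      - (A (Suc k) - A k) * ((g k - grad G (v k)) (z k) - (norm (g k - grad G (v k)))\<^sup>2 / (2 * ?s))"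
    proof (rule composite_dual_averaging_step[OF G H w pos(1,2) s A0 lt _ _ _ scm_runD(5,7,6)[OF run, folded A_def]])
      show "\<beta> * (A (Suc k) - A k)\<^sup>2 + ?s * A (Suc k) * (A (Suc k) - A k) = (\<beta> * \<nu> + \<mu> * A k) * A (Suc k)"
        using scm_A_increment_equation[OF pos, of k] A0[of k] unfolding A_def .
      show "is_arg_min (\<lambda>x. d k x + A k * H x + \<beta> * w x) (\<lambda>_. True) (z k)"
        unfolding A_def by (rule scm_run_arg_min[OF run pos(1)])
      show "scm_tau \<beta> \<mu> \<nu> k = 1 - A k / A (Suc k)" by (simp add: scm_tau_def A_def)
    qed
    then show ?case using Suc.IH by (simp add: c_def e_def \<delta>_def)
  qed
  have d: "d k = (\<Sum>i<k. (A (Suc i) - A i) *\<^sub>R g i)" for k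
    by (induction k) (simp_all add: scm_runD(4,6)[OF run] A_def)
  have Asum: "(\<Sum>i<k. A (Suc i) - A i) = A k" 
    using sum_lessThan_telescope[of A k] by (simp add: A_def)
  have "d k (z k) + A k * H (z k) + \<beta> * w (z k) \<le> d k x + A k * H x + \<beta> * w x"
    using scm_run_arg_min[OF run pos(1), of k] by (simp add: is_arg_min_UNIV A_def)
  moreover have "d k x + c k \<le> A k * G x + (\<Sum>i<k. (A (Suc i) - A i) * \<delta> i x)"
  proof -
    have "d k x + c k = (\<Sum>i<k. (A (Suc i) - A i) * (G (v i) + grad G (v i) (x - v i) + \<delta> i x))"
      unfolding d c_def \<delta>_def blinfun.sum_left sum.distrib[symmetric]
      by (intro sum.cong) (simp_all add: blinfun.scaleR_left blinfun.diff_left blinfun.diff_right algebra_simps)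
    also have "\<dots> \<le> (\<Sum>i<k. (A (Suc i) - A i) * (G x + \<delta> i x))"
      using convex_above_tangent[OF G(2,1)] less_imp_le[OF lt] by (intro sum_mono mult_left_mono) auto
    also have "\<dots> = A k * G x + (\<Sum>i<k. (A (Suc i) - A i) * \<delta> i x)"
      by (simp add: distrib_left sum.distrib sum_distrib_right[symmetric] Asum)
    finally show ?thesis .
  qed
  moreover have "(\<Sum>i<k. (A (Suc i) - A i) * (\<delta> i (x - z i) + (norm (\<delta> i))\<^sup>2 / (2 * ?s)))
     = (\<Sum>i<k. (A (Suc i) - A i) * \<delta> i x) - e k"
    unfolding e_def sum_subtractf[symmetric]
    by (intro sum.cong) (simp_all add: blinfun.diff_right algebra_simps)
  ultimately show ?thesis using lower[of k] by (simp add: algebra_simps)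
qed

section \<open>Square-integrable maps into normed spaces\<close>

definition square_integrable_map :: "'w measure \<Rightarrow> ('w \<Rightarrow> 'a::real_normed_vector) \<Rightarrow> bool"
  where "square_integrable_map M f \<longleftrightarrow> f \<in> borel_measurable M \<and> integrable M (\<lambda>\<omega>. (norm (f \<omega>))\<^sup>2)"

lemma square_sum3_le: "(a + b + c)\<^sup>2 \<le> 3 * a\<^sup>2 + 3 * b\<^sup>2 + 3 * (c::real)\<^sup>2"
  using zero_le_power2[of "a - b"] zero_le_power2[of "a - c"] zero_le_power2[of "b - c"]
  by (simp add: power2_eq_square algebra_simps)

text \<open>Every quantity of the algorithm is bounded in norm by an affine function of at most two
  earlier ones, so this one closure property replaces closure under sums, scalings and Lipschitz maps.\<close>

lemma (in finite_measure) square_integrable_map_dominated: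
  fixes f :: "'a \<Rightarrow> 'b::real_normed_vector" and f' :: "'a \<Rightarrow> 'c::real_normed_vector"
    and h :: "'a \<Rightarrow> 'd::real_normed_vector"
  assumes f: "square_integrable_map M f" and f': "square_integrable_map M f'"
    and h: "h \<in> borel_measurable M"
    and le: "\<And>\<omega>. \<omega> \<in> space M \<Longrightarrow> norm (h \<omega>) \<le> C + K * norm (f \<omega>) + L * norm (f' \<omega>)"
  shows "square_integrable_map M h"
  unfolding square_integrable_map_def
proof (rule conjI[OF h], rule Bochner_Integration.integrable_bound)
  show "integrable M (\<lambda>\<omega>. 3 * C\<^sup>2 + 3 * K\<^sup>2 * (norm (f \<omega>))\<^sup>2 + 3 * L\<^sup>2 * (norm (f' \<omega>))\<^sup>2)"
    using f f' unfolding square_integrable_map_def by simp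
  have [measurable]: "(\<lambda>\<omega>. norm (h \<omega>)) \<in> borel_measurable M"
    by (rule borel_measurable_continuous_on[OF _ h]) (intro continuous_intros)
  show "(\<lambda>\<omega>. (norm (h \<omega>))\<^sup>2) \<in> borel_measurable M" by measurable
  have "(norm (h \<omega>))\<^sup>2 \<le> 3 * C\<^sup>2 + 3 * K\<^sup>2 * (norm (f \<omega>))\<^sup>2 + 3 * L\<^sup>2 * (norm (f' \<omega>))\<^sup>2"
    if "\<omega> \<in> space M" for \<omega>
  proof -
    have "(norm (h \<omega>))\<^sup>2 \<le> (C + K * norm (f \<omega>) + L * norm (f' \<omega>))\<^sup>2"
      using le[OF that] by (intro power_mono) auto
    also have "\<dots> \<le> 3 * C\<^sup>2 + 3 * (K * norm (f \<omega>))\<^sup>2 + 3 * (L * norm (f' \<omega>))\<^sup>2"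
      by (rule square_sum3_le)
    finally show ?thesis by (simp add: power_mult_distrib)
  qed
  then show "AE \<omega> in M. norm ((norm (h \<omega>))\<^sup>2)
      \<le> norm (3 * C\<^sup>2 + 3 * K\<^sup>2 * (norm (f \<omega>))\<^sup>2 + 3 * L\<^sup>2 * (norm (f' \<omega>))\<^sup>2)"
    by (intro AE_I2) (simp add: order_trans[OF _ abs_ge_self])
qed

lemma (in finite_measure) square_integrable_map_const:
  "square_integrable_map M (\<lambda>_. c)"
  by (simp add: square_integrable_map_def)

lemma square_integrable_map_cong:
  assumes "\<And>\<omega>. \<omega> \<in> space M \<Longrightarrow> f \<omega> = h \<omega>"
  shows "square_integrable_map M f \<longleftrightarrow> square_integrable_map M h"
  unfolding square_integrable_map_def using assms
  by (auto cong: measurable_cong Bochner_Integration.integrable_cong)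

lemma square_integrable_map_mult_integrable:
  fixes f h :: "'w \<Rightarrow> real"
  assumes "square_integrable_map M f" "square_integrable_map M h"
  shows "integrable M (\<lambda>\<omega>. f \<omega> * h \<omega>)"
proof (rule Bochner_Integration.integrable_bound)
  have [measurable]: "f \<in> borel_measurable M" "h \<in> borel_measurable M"
    using assms by (auto simp: square_integrable_map_def)
  show "integrable M (\<lambda>\<omega>. (norm (f \<omega>))\<^sup>2 + (norm (h \<omega>))\<^sup>2)"
    using assms by (simp add: square_integrable_map_def)
  show "(\<lambda>\<omega>. f \<omega> * h \<omega>) \<in> borel_measurable M" by measurable
  have "\<bar>a * b\<bar> \<le> a\<^sup>2 + b\<^sup>2" for a b :: real
    using zero_le_power2[of "a - b"] zero_le_power2[of "a + b"] zero_le_power2[of a] zero_le_power2[of b]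
    unfolding power2_sum power2_diff by (simp add: abs_le_iff)
  then show "AE \<omega> in M. norm (f \<omega> * h \<omega>) \<le> norm ((norm (f \<omega>))\<^sup>2 + (norm (h \<omega>))\<^sup>2)" by simp
qed

lemma (in finite_measure) square_integrable_map_pairing:
  fixes f :: "'a \<Rightarrow> 'b::real_normed_vector \<Rightarrow>\<^sub>L real"
  assumes "square_integrable_map M f"
  shows "square_integrable_map M (\<lambda>\<omega>. f \<omega> x)"
proof -
  have m: "(\<lambda>\<omega>. f \<omega> x) \<in> borel_measurable M"
    by (rule borel_measurable_blinfun_eval) (use assms in \<open>simp add: square_integrable_map_def\<close>)
  have "norm (f \<omega> x) \<le> 0 + norm x * norm (f \<omega>) + 0 * norm (f \<omega>)" if "\<omega> \<in> space M" for \<omega>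
    using norm_blinfun[of "f \<omega>" x] by (simp add: mult.commute)
  then show ?thesis
    by (intro square_integrable_map_dominated[OF assms assms m, where C = 0 and K = "norm x" and L = 0])
qed

lemma subalgebra_vimage_algebra:
  assumes "f \<in> M \<rightarrow>\<^sub>M N"
  shows "subalgebra M (vimage_algebra (space M) f N)"
proof -
  have "f \<in> space M \<rightarrow> space N" using assms by (simp add: measurable_def)
  then have "sets (vimage_algebra (space M) f N) = {f -` B \<inter> space M |B. B \<in> sets N}"
    by (rule sets_vimage_algebra2)
  then show ?thesis unfolding subalgebra_def using measurable_sets[OF assms] by auto
qed

section \<open>Expectation of the noise\<close>

text \<open>The locale carries coordinates instead of the existence of a finite spanning set, because the mean-zero argument
  expands vectors in them.\<close>

locale stochastic_composite_minimization = prob_space M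
  for M :: "'w measure" +
  fixes G H w :: "'a::real_normed_vector \<Rightarrow> real"
    and g d :: "nat \<Rightarrow> 'w \<Rightarrow> 'a \<Rightarrow>\<^sub>L real"
    and y z v :: "nat \<Rightarrow> 'w \<Rightarrow> 'a"
    and y0 :: 'a
    and \<beta> \<mu> \<nu> \<sigma> :: real
    and n :: nat and b :: "nat \<Rightarrow> 'a" and \<phi> :: "nat \<Rightarrow> 'a \<Rightarrow>\<^sub>L real"
  assumes coords: "coordinate_system n b \<phi>"
    and pos: "\<beta> > 0" "\<mu> > 0" "\<nu> > 0"
    and G: "convex_on UNIV G" "smooth_wrt_norm \<beta> G"
    and H: "strongly_convex \<mu> H" and w: "strongly_convex \<nu> w"
    and g_measurable: "\<And>i. g i \<in> borel_measurable M"
    and run: "\<And>\<omega>. \<omega> \<in> space M \<Longrightarrow>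
      scm_run \<beta> \<mu> \<nu> H w y0 (\<lambda>i. g i \<omega>) (\<lambda>i. y i \<omega>) (\<lambda>i. z i \<omega>) (\<lambda>i. v i \<omega>) (\<lambda>i. d i \<omega>)"
    and unbiased: "\<And>i. has_dual_cond_exp M (scm_history \<beta> \<mu> \<nu> G M y z v d i) (g i) (\<lambda>\<omega>. grad G (v i \<omega>))"
    and noise_bound: "\<And>i. AE \<omega> in M.
      nn_cond_exp M (scm_history \<beta> \<mu> \<nu> G M y z v d i)
        (\<lambda>\<omega>. ennreal ((norm (g i \<omega> - grad G (v i \<omega>)))\<^sup>2)) \<omega> \<le> ennreal (\<sigma>\<^sup>2)"
begin

abbreviation history :: "nat \<Rightarrow> 'w measure" where "history \<equiv> scm_history \<beta> \<mu> \<nu> G M y z v d"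
abbreviation A :: "nat \<Rightarrow> real" where "A \<equiv> scm_A \<beta> \<mu> \<nu>"
abbreviation \<tau> :: "nat \<Rightarrow> real" where "\<tau> \<equiv> scm_tau \<beta> \<mu> \<nu>"

definition \<delta> :: "nat \<Rightarrow> 'w \<Rightarrow> 'a \<Rightarrow>\<^sub>L real" where "\<delta> i \<omega> = g i \<omega> - grad G (v i \<omega>)"

lemmas A_nonneg = scm_A_nonneg[OF pos]
lemmas A_less = scm_A_strict_step[OF pos A_nonneg]
lemmas dual_coords = coordinate_system_dual[OF coords]
lemmas H_uniformly_convex = strongly_convex_imp_uniformly_convex[OF coords H]
lemmas w_uniformly_convex = strongly_convex_imp_uniformly_convex[OF coords w]

lemma z_lipschitz:
  assumes "\<omega> \<in> space M" "\<omega>' \<in> space M"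
  shows "norm (z k \<omega> - z k \<omega>') \<le> 1 / (A k * \<mu> + \<beta> * \<nu>) * norm (d k \<omega> - d k \<omega>')"
proof -
  have m: "A k * \<mu> + \<beta> * \<nu> > 0" using A_nonneg[of k] pos by (simp add: add_nonneg_pos)
  have "norm (z k \<omega> - z k \<omega>') \<le> norm (d k \<omega> - d k \<omega>') / (A k * \<mu> + \<beta> * \<nu>)"
  proof (rule arg_min_lipschitz[OF m])
    show "uniformly_convex (A k * \<mu> + \<beta> * \<nu>) (\<lambda>x. l x + (A k * H x + \<beta> * w x))" for l :: "'a \<Rightarrow>\<^sub>L real"
      using uniformly_convex_combination[OF H_uniformly_convex w_uniformly_convex A_nonneg[of k], of \<beta> l] pos
      by (simp add: add.assoc)
    show "is_arg_min (\<lambda>x. d k \<omega> x + (A k * H x + \<beta> * w x)) (\<lambda>_. True) (z k \<omega>)"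
      using scm_run_arg_min[OF run[OF assms(1)] pos(1)] by (simp add: add.assoc)
    show "is_arg_min (\<lambda>x. d k \<omega>' x + (A k * H x + \<beta> * w x)) (\<lambda>_. True) (z k \<omega>')"
      using scm_run_arg_min[OF run[OF assms(2)] pos(1)] by (simp add: add.assoc)
  qed
  then show ?thesis by simp
qed

text \<open>Neither \<open>z\<close> nor \<open>y\<close> is assumed to be a random variable; that follows from uniqueness and Lipschitz
  dependence of the minimizers.\<close>

lemma z_measurable_if_d: "d k \<in> borel_measurable M \<Longrightarrow> z k \<in> borel_measurable M"
proof (rule borel_measurable_lipschitz_factor[where L = "1 / (A k * \<mu> + \<beta> * \<nu>)"])
  show "1 / (A k * \<mu> + \<beta> * \<nu>) > 0" using A_nonneg[of k] pos by (simp add: add_nonneg_pos)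
qed (use z_lipschitz in \<open>auto simp: dist_norm\<close>)

lemma iterates_measurable:
  "d k \<in> borel_measurable M \<and> y k \<in> borel_measurable M \<and> z k \<in> borel_measurable M"
proof (induction k)
  case 0
  have "d 0 \<in> borel_measurable M \<longleftrightarrow> (\<lambda>_. 0::'a \<Rightarrow>\<^sub>L real) \<in> borel_measurable M"
    by (intro measurable_cong scm_runD(4)[OF run])
  moreover have "y 0 \<in> borel_measurable M \<longleftrightarrow> (\<lambda>_. y0) \<in> borel_measurable M"
    by (intro measurable_cong scm_runD(3)[OF run])
  ultimately show ?case using z_measurable_if_d by simp
next
  case (Suc k)
  have "d (Suc k) \<in> borel_measurable M \<longleftrightarrow> (\<lambda>\<omega>. 1 *\<^sub>R d k \<omega> + (A (Suc k) - A k) *\<^sub>R g k \<omega>) \<in> borel_measurable M"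
    by (intro measurable_cong) (simp add: scm_runD(6)[OF run])
  then have d: "d (Suc k) \<in> borel_measurable M"
    using borel_measurable_lincomb[OF dual_coords] Suc g_measurable by blast
  then have z: "z (Suc k) \<in> borel_measurable M" by (rule z_measurable_if_d)
  have "y (Suc k) \<in> borel_measurable M \<longleftrightarrow>
      (\<lambda>\<omega>. (1 - \<tau> k) *\<^sub>R y k \<omega> + \<tau> k *\<^sub>R z (Suc k) \<omega>) \<in> borel_measurable M"
    by (intro measurable_cong) (rule scm_runD(7)[OF run])
  then have "y (Suc k) \<in> borel_measurable M"
    using borel_measurable_lincomb[OF coords] Suc z by blast
  with d z show ?case by blast
qed

lemma v_measurable: "v k \<in> borel_measurable M"
proof -
  have "v k \<in> borel_measurable M \<longleftrightarrow>
      (\<lambda>\<omega>. (1 - \<tau> k) *\<^sub>R y k \<omega> + \<tau> k *\<^sub>R z k \<omega>) \<in> borel_measurable M"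
    by (intro measurable_cong) (rule scm_runD(5)[OF run])
  then show ?thesis using borel_measurable_lincomb[OF coords] iterates_measurable by blast
qed

lemma grad_v_measurable: "(\<lambda>\<omega>. grad G (v k \<omega>)) \<in> borel_measurable M"
  by (rule borel_measurable_lipschitz_factor[OF v_measurable[of k] pos(1)])
     (simp add: dist_norm grad_lipschitz[OF G(2)])

lemma \<delta>_measurable: "\<delta> k \<in> borel_measurable M"
  using borel_measurable_lincomb[OF dual_coords g_measurable grad_v_measurable, of 1 k "-1"]
  by (simp add: \<delta>_def[abs_def])

text \<open>Conditional expectations with respect to the history are meaningful only if it is a
  sub-\<open>\<sigma>\<close>-algebra, that is, if its generator is measurable.\<close>

lemma history_generator_measurable:
  "(\<lambda>\<omega>. (y k \<omega>, z k \<omega>, d k \<omega>, scm_c \<beta> \<mu> \<nu> G (\<lambda>i. v i \<omega>) k))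
    \<in> M \<rightarrow>\<^sub>M borel \<Otimes>\<^sub>M borel \<Otimes>\<^sub>M borel \<Otimes>\<^sub>M borel"
proof -
  have [measurable]: "(\<lambda>\<omega>. G (v i \<omega>)) \<in> borel_measurable M" for i
    by (rule measurable_compose[OF v_measurable convex_borel_measurable[OF coords G(1)]])
  have [measurable]: "(\<lambda>\<omega>. grad G (v i \<omega>) (v i \<omega>)) \<in> borel_measurable M" for i
    by (rule borel_measurable_pairing[OF coords grad_v_measurable v_measurable])
  have "(\<lambda>\<omega>. scm_c \<beta> \<mu> \<nu> G (\<lambda>i. v i \<omega>) k) \<in> borel_measurable M"
    unfolding scm_c_def by measurable
  then show ?thesis using iterates_measurable by (intro measurable_Pair) auto
qed

lemma history_subalgebra: "subalgebra M (history k)"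
  unfolding scm_history_def by (rule subalgebra_vimage_algebra[OF history_generator_measurable])

lemma z_history_measurable: "z k \<in> borel_measurable (history k)"
proof -
  let ?T = "\<lambda>\<omega>. (y k \<omega>, z k \<omega>, d k \<omega>, scm_c \<beta> \<mu> \<nu> G (\<lambda>i. v i \<omega>) k)"
  have "?T \<in> history k \<rightarrow>\<^sub>M borel \<Otimes>\<^sub>M borel \<Otimes>\<^sub>M borel \<Otimes>\<^sub>M borel"
    unfolding scm_history_def
    by (rule measurable_vimage_algebra1) (simp add: space_pair_measure)
  then have "(\<lambda>\<omega>. fst (snd (?T \<omega>))) \<in> history k \<rightarrow>\<^sub>M borel"
    by (intro measurable_compose[OF measurable_compose[OF _ measurable_snd] measurable_fst])
  then show ?thesis by simp
qed

lemma history_sigma_finite: "sigma_finite_subalgebra M (history k)"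
  by (intro finite_measure_subalgebra_is_sigma_finite finite_measure_subalgebra.intro
      finite_measure_subalgebra_axioms.intro history_subalgebra finite_measure_axioms)

lemma \<delta>_second_moment:
  shows \<delta>_square_integrable: "square_integrable_map M (\<delta> k)"
    and \<delta>_variance: "expectation (\<lambda>\<omega>. (norm (\<delta> k \<omega>))\<^sup>2) \<le> \<sigma>\<^sup>2"
proof -
  have [measurable]: "(\<lambda>\<omega>. norm (\<delta> k \<omega>)) \<in> borel_measurable M"
    by (rule borel_measurable_continuous_on[OF _ \<delta>_measurable]) (intro continuous_intros)
  let ?f = "\<lambda>\<omega>. ennreal ((norm (\<delta> k \<omega>))\<^sup>2)"
  have "(\<integral>\<^sup>+ \<omega>. ?f \<omega> \<partial>M) = (\<integral>\<^sup>+ \<omega>. 1 * ?f \<omega> \<partial>M)" by simp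
  also have "\<dots> = (\<integral>\<^sup>+ \<omega>. 1 * nn_cond_exp M (history k) ?f \<omega> \<partial>M)"
    by (rule sigma_finite_subalgebra.nn_cond_exp_intg[OF history_sigma_finite, symmetric]) measurable
  also have "\<dots> \<le> (\<integral>\<^sup>+ \<omega>. ennreal (\<sigma>\<^sup>2) \<partial>M)"
    using noise_bound[of k] by (intro nn_integral_mono_AE) (simp add: \<delta>_def)
  also have "\<dots> = ennreal (\<sigma>\<^sup>2)" by (simp add: emeasure_space_1)
  finally have le: "(\<integral>\<^sup>+ \<omega>. ?f \<omega> \<partial>M) \<le> ennreal (\<sigma>\<^sup>2)" .
  have int: "integrable M (\<lambda>\<omega>. (norm (\<delta> k \<omega>))\<^sup>2)"
  proof (rule integrableI_bounded)
    show "(\<integral>\<^sup>+ \<omega>. ennreal (norm ((norm (\<delta> k \<omega>))\<^sup>2)) \<partial>M) < \<infinity>"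
      using le by (simp add: le_less_trans)
  qed measurable
  then show "square_integrable_map M (\<delta> k)" using \<delta>_measurable by (simp add: square_integrable_map_def)
  have "ennreal (expectation (\<lambda>\<omega>. (norm (\<delta> k \<omega>))\<^sup>2)) \<le> ennreal (\<sigma>\<^sup>2)"
    using le nn_integral_eq_integral[OF int] by simp
  then show "expectation (\<lambda>\<omega>. (norm (\<delta> k \<omega>))\<^sup>2) \<le> \<sigma>\<^sup>2" by (subst (asm) ennreal_le_iff) auto
qed

text \<open>The pairing of the noise with \<open>z k\<close> must be integrable before its mean can be zero. Square
  integrability of both factors spreads along the recursion from the second moments of the noise.\<close>

lemma iterates_square_integrable:
  "square_integrable_map M (d k) \<and> square_integrable_map M (y k) \<and> square_integrable_map M (z k) \<and>
   square_integrable_map M (\<lambda>\<omega>. grad G (v k \<omega>)) \<and> square_integrable_map M (g k)"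
proof -
  note dom = square_integrable_map_dominated
  have zd: "square_integrable_map M (z k)" if d: "square_integrable_map M (d k)" for k
  proof -
    \<comment> \<open>A Lipschitz function on the range of \<open>d k\<close> grows at most linearly, measured from any one outcome.\<close>
    obtain \<omega>0 where w0: "\<omega>0 \<in> space M" using not_empty by blast
    define L where "L = 1 / (A k * \<mu> + \<beta> * \<nu>)"
    have L: "L \<ge> 0" unfolding L_def using A_nonneg[of k] pos by (simp add: add_nonneg_nonneg)
    show ?thesis
    proof (rule dom[OF d d])
      fix \<omega> assume "\<omega> \<in> space M"
      then have "norm (z k \<omega> - z k \<omega>0) \<le> L * norm (d k \<omega> - d k \<omega>0)"
        unfolding L_def by (intro z_lipschitz w0)
      also have "\<dots> \<le> L * (norm (d k \<omega>) + norm (d k \<omega>0))" by (intro mult_left_mono norm_triangle_ineq4 L)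
      finally show "norm (z k \<omega>) \<le> (norm (z k \<omega>0) + L * norm (d k \<omega>0)) + L * norm (d k \<omega>) + 0 * norm (d k \<omega>)"
        using norm_triangle_sub[of "z k \<omega>" "z k \<omega>0"] by (simp add: algebra_simps)
    qed (use iterates_measurable in blast)
  qed
  have gv: "square_integrable_map M (\<lambda>\<omega>. grad G (v k \<omega>))"
    if y: "square_integrable_map M (y k)" and z: "square_integrable_map M (z k)" for k
  proof (rule dom[OF y z grad_v_measurable])
    fix \<omega> assume w: "\<omega> \<in> space M"
    have "norm (grad G (v k \<omega>) - grad G 0) \<le> \<beta> * norm (v k \<omega>)"
      using grad_lipschitz[OF G(2), of "v k \<omega>" 0] by simp
    also have "norm (v k \<omega>) \<le> \<bar>1 - \<tau> k\<bar> * norm (y k \<omega>) + \<bar>\<tau> k\<bar> * norm (z k \<omega>)"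
      unfolding scm_runD(5)[OF run[OF w]] norm_scaleR[symmetric] by (rule norm_triangle_ineq)
    finally show "norm (grad G (v k \<omega>)) \<le> norm (grad G 0) + (\<beta> * \<bar>1 - \<tau> k\<bar>) * norm (y k \<omega>) + (\<beta> * \<bar>\<tau> k\<bar>) * norm (z k \<omega>)"
      using norm_triangle_sub[of "grad G (v k \<omega>)" "grad G 0"] pos by (simp add: algebra_simps)
  qed
  have gk: "square_integrable_map M (g k)" if "square_integrable_map M (\<lambda>\<omega>. grad G (v k \<omega>))" for k
  proof (rule dom[OF \<delta>_square_integrable that g_measurable])
    show "norm (g k \<omega>) \<le> 0 + 1 * norm (\<delta> k \<omega>) + 1 * norm (grad G (v k \<omega>))" for \<omega>
      using norm_triangle_ineq[of "\<delta> k \<omega>" "grad G (v k \<omega>)"] by (simp add: \<delta>_def)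
  qed
  have dy: "square_integrable_map M (d k) \<and> square_integrable_map M (y k)" for k
  proof (induction k)
    case 0
    have "square_integrable_map M (d 0) \<longleftrightarrow> square_integrable_map M (\<lambda>_. 0::'a \<Rightarrow>\<^sub>L real)"
      by (intro square_integrable_map_cong scm_runD(4)[OF run])
    moreover have "square_integrable_map M (y 0) \<longleftrightarrow> square_integrable_map M (\<lambda>_. y0)"
      by (intro square_integrable_map_cong scm_runD(3)[OF run])
    ultimately show ?case by (simp add: square_integrable_map_const)
  next
    case (Suc k)
    have d: "square_integrable_map M (d (Suc k))"
    proof (rule dom[of "d k" "g k"])
      show "norm (d (Suc k) \<omega>) \<le> 0 + 1 * norm (d k \<omega>) + (A (Suc k) - A k) * norm (g k \<omega>)"
        if "\<omega> \<in> space M" for \<omega>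
        using norm_triangle_ineq[of "d k \<omega>" "(A (Suc k) - A k) *\<^sub>R g k \<omega>"] A_less[of k]
        by (simp add: scm_runD(6)[OF run[OF that]])
    qed (use Suc zd gv gk iterates_measurable in blast)+
    have "square_integrable_map M (y (Suc k))"
    proof (rule dom[of "y k" "z (Suc k)"])
      show "norm (y (Suc k) \<omega>) \<le> 0 + \<bar>1 - \<tau> k\<bar> * norm (y k \<omega>) + \<bar>\<tau> k\<bar> * norm (z (Suc k) \<omega>)"
        if "\<omega> \<in> space M" for \<omega>
        using norm_triangle_ineq[of "(1 - \<tau> k) *\<^sub>R y k \<omega>" "\<tau> k *\<^sub>R z (Suc k) \<omega>"]
        by (simp add: scm_runD(7)[OF run[OF that]])
    qed (use Suc zd[OF d] iterates_measurable in blast)+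
    with d show ?case ..
  qed
  then show ?thesis using zd gv gk by blast
qed

text \<open>The point \<open>z k\<close> is part of the history, so its coordinates can be pulled out of the conditional
  expectation of the gradient.\<close>

lemma \<delta>_mean_zero:
  shows \<delta>_pairing_integrable: "integrable M (\<lambda>\<omega>. \<delta> k \<omega> (x - z k \<omega>))"
    and \<delta>_pairing_expectation: "expectation (\<lambda>\<omega>. \<delta> k \<omega> (x - z k \<omega>)) = 0"
proof -
  define c where "c j \<omega> = \<phi> j (x - z k \<omega>)" for j \<omega>
  have c_history: "c j \<in> borel_measurable (history k)" for j
    unfolding c_def blinfun.diff_right
    using borel_measurable_blinfun_apply[OF z_history_measurable] by (intro borel_measurable_diff) auto
  have z: "square_integrable_map M (z k)" using iterates_square_integrable by blast
  have c: "square_integrable_map M (c j)" for j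
  proof (rule square_integrable_map_dominated[OF z z])
    show "c j \<in> borel_measurable M"
      using c_history history_subalgebra measurable_from_subalg by blast
    have "norm (c j \<omega>) \<le> norm (\<phi> j) * (norm x + norm (z k \<omega>))" for \<omega>
      unfolding c_def by (rule order_trans[OF norm_blinfun]) (intro mult_left_mono norm_triangle_ineq4, simp)
    then show "norm (c j \<omega>) \<le> norm (\<phi> j) * norm x + norm (\<phi> j) * norm (z k \<omega>) + 0 * norm (z k \<omega>)" for \<omega>
      by (simp add: distrib_left)
  qed
  have g: "integrable M (\<lambda>\<omega>. c j \<omega> * g k \<omega> u)" for j u
    using iterates_square_integrable by (intro square_integrable_map_mult_integrable c square_integrable_map_pairing) blast
  have v: "integrable M (\<lambda>\<omega>. c j \<omega> * grad G (v k \<omega>) u)" for j u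
    using iterates_square_integrable by (intro square_integrable_map_mult_integrable c square_integrable_map_pairing) blast
  have eq: "expectation (\<lambda>\<omega>. c j \<omega> * g k \<omega> u) = expectation (\<lambda>\<omega>. c j \<omega> * grad G (v k \<omega>) u)" for j u
  proof -
    have [measurable]: "(\<lambda>\<omega>. g k \<omega> u) \<in> borel_measurable M"
      by (rule borel_measurable_blinfun_eval[OF g_measurable])
    have [measurable]: "c j \<in> borel_measurable M" "(\<lambda>\<omega>. grad G (v k \<omega>) u) \<in> borel_measurable M"
      using c[of j] square_integrable_map_pairing iterates_square_integrable unfolding square_integrable_map_def by blast+
    have "expectation (\<lambda>\<omega>. c j \<omega> * g k \<omega> u)
        = expectation (\<lambda>\<omega>. c j \<omega> * real_cond_exp M (history k) (\<lambda>\<omega>. g k \<omega> u) \<omega>)"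
      by (rule sigma_finite_subalgebra.real_cond_exp_intg(2)[OF history_sigma_finite g c_history, symmetric]) measurable
    also have "\<dots> = expectation (\<lambda>\<omega>. c j \<omega> * grad G (v k \<omega>) u)"
    proof (rule integral_cong_AE)
      show "AE \<omega> in M. c j \<omega> * real_cond_exp M (history k) (\<lambda>\<omega>. g k \<omega> u) \<omega> = c j \<omega> * grad G (v k \<omega>) u"
        using unbiased[of k] unfolding has_dual_cond_exp_def by auto
    qed measurable
    finally show ?thesis .
  qed
  have expand: "\<delta> k \<omega> (x - z k \<omega>) = (\<Sum>j<n. c j \<omega> * g k \<omega> (b j) - c j \<omega> * grad G (v k \<omega>) (b j))" for \<omega>
    by (subst coordinate_system_expand[OF coords, of "x - z k \<omega>", symmetric])
       (simp add: blinfun.sum_right blinfun.scaleR_right c_def \<delta>_def blinfun.diff_left right_diff_distrib)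
  show "integrable M (\<lambda>\<omega>. \<delta> k \<omega> (x - z k \<omega>))" unfolding expand using g v by simp
  show "expectation (\<lambda>\<omega>. \<delta> k \<omega> (x - z k \<omega>)) = 0" unfolding expand using g v by (simp add: eq)
qed

text \<open>Take expectations in the pathwise bound. The noise terms contribute at most \<open>\<sigma>\<^sup>2 / (2 * sqrt (\<mu> * \<beta>))\<close> times the
  sum of the increments of \<open>A\<close>, which is \<open>A k\<close>, so the division by \<open>A k\<close> leaves a constant.\<close>

lemma expected_gap:
  fixes ystar :: 'a
  assumes opt: "is_arg_min (\<lambda>x. G x + H x) (\<lambda>_. True) ystar" and k: "A k > 0"
  shows expected_gap_integrable: "integrable M (\<lambda>\<omega>. (G (y k \<omega>) + H (y k \<omega>)) - (G ystar + H ystar))"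
    and expected_gap_bound: "expectation (\<lambda>\<omega>. (G (y k \<omega>) + H (y k \<omega>)) - (G ystar + H ystar))
      \<le> \<beta> * (w ystar - w y0) / A k + \<sigma>\<^sup>2 / (2 * sqrt (\<mu> * \<beta>))"
proof -
  let ?s = "sqrt (\<mu> * \<beta>)"
  have s: "?s > 0" using pos by simp
  define gap where "gap \<omega> = (G (y k \<omega>) + H (y k \<omega>)) - (G ystar + H ystar)" for \<omega>
  define noise where "noise i \<omega> = \<delta> i \<omega> (ystar - z i \<omega>) + (norm (\<delta> i \<omega>))\<^sup>2 / (2 * ?s)" for i \<omega>
  define R where "R \<omega> = \<beta> * (w ystar - w y0) + (\<Sum>i<k. (A (Suc i) - A i) * noise i \<omega>)" for \<omega>
  have noise_int: "integrable M (noise i)" for i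
    using \<delta>_square_integrable[of i] \<delta>_pairing_integrable[of i ystar]
    unfolding noise_def square_integrable_map_def by simp
  have noise_le: "expectation (noise i) \<le> \<sigma>\<^sup>2 / (2 * ?s)" for i
  proof -
    have "expectation (noise i) = expectation (\<lambda>\<omega>. (norm (\<delta> i \<omega>))\<^sup>2) / (2 * ?s)"
      using \<delta>_square_integrable[of i] \<delta>_pairing_integrable[of i ystar]
      unfolding noise_def square_integrable_map_def by (simp add: \<delta>_pairing_expectation)
    then show ?thesis using \<delta>_variance[of i] s by (simp add: divide_right_mono)
  qed
  have R_int: "integrable M R" unfolding R_def using noise_int by simp
  have gap_R: "A k * gap \<omega> \<le> R \<omega>" if "\<omega> \<in> space M" for \<omega>
    using scm_pathwise_bound[OF G H_uniformly_convex w_uniformly_convex pos run[OF that], of k ystar]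
    by (simp add: gap_def R_def noise_def \<delta>_def)
  have gap_nonneg: "gap \<omega> \<ge> 0" for \<omega> using opt by (simp add: gap_def is_arg_min_UNIV)
  have "convex_on UNIV (\<lambda>x. G x + H x)"
    using G(1) H by (intro convex_on_add) (auto simp: strongly_convex_def)
  then have "(\<lambda>x. G x + H x) \<in> borel_measurable borel" by (rule convex_borel_measurable[OF coords])
  from measurable_compose[OF _ this] have [measurable]: "(\<lambda>\<omega>. G (y k \<omega>) + H (y k \<omega>)) \<in> borel_measurable M"
    using iterates_measurable by blast
  have gap_int: "integrable M gap"
  proof (rule Bochner_Integration.integrable_bound)
    show "integrable M (\<lambda>\<omega>. R \<omega> / A k)" using R_int by simp
    show "gap \<in> borel_measurable M" unfolding gap_def by measurable
    show "AE \<omega> in M. norm (gap \<omega>) \<le> norm (R \<omega> / A k)"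
    proof (intro AE_I2)
      fix \<omega> assume "\<omega> \<in> space M"
      then have "gap \<omega> \<le> R \<omega> / A k" using gap_R k by (simp add: field_simps)
      then show "norm (gap \<omega>) \<le> norm (R \<omega> / A k)"
        using gap_nonneg[of \<omega>] abs_ge_self[of "R \<omega> / A k"] unfolding real_norm_def by linarith
    qed
  qed
  then show "integrable M (\<lambda>\<omega>. (G (y k \<omega>) + H (y k \<omega>)) - (G ystar + H ystar))"
    unfolding gap_def .
  have "A k * expectation gap = expectation (\<lambda>\<omega>. A k * gap \<omega>)" by simp
  also have "\<dots> \<le> expectation R" using gap_int R_int gap_R by (intro integral_mono) auto
  also have "\<dots> = \<beta> * (w ystar - w y0) + (\<Sum>i<k. (A (Suc i) - A i) * expectation (noise i))"
    unfolding R_def using noise_int by (simp add: prob_space)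
  also have "\<dots> \<le> \<beta> * (w ystar - w y0) + (\<Sum>i<k. (A (Suc i) - A i) * (\<sigma>\<^sup>2 / (2 * ?s)))"
    using noise_le A_less by (intro add_left_mono sum_mono mult_left_mono) (auto simp: less_imp_le)
  also have "(\<Sum>i<k. (A (Suc i) - A i) * (\<sigma>\<^sup>2 / (2 * ?s))) = A k * (\<sigma>\<^sup>2 / (2 * ?s))"
    unfolding sum_distrib_right[symmetric] sum_lessThan_telescope by simp
  finally have "A k * expectation gap \<le> A k * (\<beta> * (w ystar - w y0) / A k + \<sigma>\<^sup>2 / (2 * ?s))"
    using k by (simp add: distrib_left)
  then show "expectation (\<lambda>\<omega>. (G (y k \<omega>) + H (y k \<omega>)) - (G ystar + H ystar))
      \<le> \<beta> * (w ystar - w y0) / A k + \<sigma>\<^sup>2 / (2 * ?s)"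
    using k unfolding gap_def[symmetric] by simp
qed

end
section \<open>Convergence in expectation\<close>

theorem theorem1:
  fixes G H w F :: "'a::real_normed_vector \<Rightarrow> real"
    and M :: "'w measure"
    and g d :: "nat \<Rightarrow> 'w \<Rightarrow> 'a \<Rightarrow>\<^sub>L real"
    and y z v :: "nat \<Rightarrow> 'w \<Rightarrow> 'a"
    and y0 ystar :: 'a
    and \<beta> \<mu> \<nu> \<sigma> :: real
    and k :: nat
  assumes "\<exists>B::'a set. finite B \<and> span B = UNIV"
    and "\<beta> > 0" and "\<mu> > 0" and "\<nu> > 0"
    and "convex_on UNIV G" and "smooth_wrt_norm \<beta> G"
    and "strongly_convex \<mu> H" and "strongly_convex \<nu> w"
    and "F = (\<lambda>x. G x + H x)"
    and "prob_space M"
    and "\<And>i. g i \<in> borel_measurable M"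
    and "\<And>\<omega>. \<omega> \<in> space M \<Longrightarrow>
      scm_run \<beta> \<mu> \<nu> H w y0 (\<lambda>i. g i \<omega>) (\<lambda>i. y i \<omega>) (\<lambda>i. z i \<omega>) (\<lambda>i. v i \<omega>) (\<lambda>i. d i \<omega>)"
    and "\<And>i. has_dual_cond_exp M (scm_history \<beta> \<mu> \<nu> G M y z v d i) (g i) (\<lambda>\<omega>. grad G (v i \<omega>))"
    and "\<And>i. AE \<omega> in M.
      nn_cond_exp M (scm_history \<beta> \<mu> \<nu> G M y z v d i)
        (\<lambda>\<omega>. ennreal ((norm (g i \<omega> - grad G (v i \<omega>)))\<^sup>2)) \<omega> \<le> ennreal (\<sigma>\<^sup>2)"
    and "is_arg_min F (\<lambda>_. True) ystar"
    and "k \<ge> 1"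
  shows "D_gap w ystar y0 \<ge> 0 \<and>
    integrable M (\<lambda>\<omega>. F (y k \<omega>) - F ystar) \<and>
    prob_space.expectation M (\<lambda>\<omega>. F (y k \<omega>) - F ystar)
      \<le> (sqrt \<beta> + sqrt \<mu>) / (\<nu> * sqrt \<beta>)
          * exp (- ((real k - 1) * sqrt \<mu> / (4 * (sqrt \<beta> + sqrt \<mu>)))) * \<beta> * D_gap w ystar y0
        + \<sigma>\<^sup>2 / (2 * sqrt (\<mu> * \<beta>))"
proof -
  obtain n b \<phi> where coords: "coordinate_system n b (\<phi>::nat \<Rightarrow> 'a \<Rightarrow>\<^sub>L real)"
    using coordinate_system_exists[OF assms(1)] by blast
  interpret stochastic_composite_minimization M G H w g d y z v y0 \<beta> \<mu> \<nu> \<sigma> n b \<phi>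
    by (intro stochastic_composite_minimization.intro stochastic_composite_minimization_axioms.intro)
       (use assms coords in blast)+
  obtain \<omega> where "\<omega> \<in> space M" using not_empty by blast
  then have D: "D_gap w ystar y0 \<ge> 0"
    using scm_runD(1)[OF run] by (simp add: D_gap_def is_arg_min_UNIV)
  have opt: "is_arg_min (\<lambda>x. G x + H x) (\<lambda>_. True) ystar" using assms(9,15) by simp
  obtain j where j: "k = Suc j" using \<open>k \<ge> 1\<close> by (cases k) auto
  let ?C = "\<nu> * sqrt \<beta> / (sqrt \<beta> + sqrt \<mu>)"
  let ?e = "(real k - 1) * sqrt \<mu> / (4 * (sqrt \<beta> + sqrt \<mu>))"
  have "sqrt \<beta> > 0" "sqrt \<mu> > 0" using pos by auto
  then have C: "?C > 0" using pos by (simp add: add_pos_pos)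
  have A_ge: "?C * exp ?e \<le> A k" using scm_A_lower_bound[OF pos, of j] by (simp add: j)
  moreover have Ce: "?C * exp ?e > 0" by (intro mult_pos_pos C exp_gt_zero)
  ultimately have Ak: "A k > 0" by linarith
  \<comment> \<open>The prefactor in the rate is the reciprocal of the first weight.\<close>
  have "\<beta> * D_gap w ystar y0 / A k \<le> \<beta> * D_gap w ystar y0 / (?C * exp ?e)"
    using pos D by (intro divide_left_mono[OF A_ge _ mult_pos_pos[OF Ak Ce]]) simp
  also have "\<dots> = inverse ?C * exp (- ?e) * (\<beta> * D_gap w ystar y0)"
    unfolding exp_minus inverse_mult_distrib[symmetric] by (simp only: divide_inverse mult.commute)
  also have "\<dots> = (sqrt \<beta> + sqrt \<mu>) / (\<nu> * sqrt \<beta>) * exp (- ?e) * \<beta> * D_gap w ystar y0"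
    by (simp add: inverse_divide)
  finally show ?thesis
    using D expected_gap_integrable[OF opt Ak] expected_gap_bound[OF opt Ak]
    unfolding assms(9) D_gap_def by auto
qed

end
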